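(* Let $\alpha\in[-1,1]$, $I:=[-1,1]\setminus\{\alpha\}$, and let $n_1,n_2$ be positive integers with $n_1\ge n_2+2$. Let the non-polynomial interpolation operator $\mathcal{S}^{\alpha}_{n_1,n_2}$ be based on a set of $n_1$ Chebyshev points of the first kind and $n_2$ other distinct points. Then, for functions of the form $K(x)=g_1(x)+g_2(x)\log|x-\alpha|$ with $g_1$ and $g_2$ smooth, the error of the associated quadrature $I_{n_1,n_2}[K]$ for the integral $I[K]:=\int_{-1}^1K(x)\,dx$ satisfies $$\bigl|I[K]-I_{n_1,n_2}[K]\bigr|=\left|\int_{-1}^1\bigl(K(x)-\mathcal{S}^{\alpha}_{n_1,n_2}K(x)\bigr)\,dx\right|\le\|K-\mathcal{S}^{\alpha}_{n_1,n_2}K\|_1\le\frac{8c\,\bigl(1+\|\mathcal{S}^{\alpha}_{n_1,n_2}\|_{1,\infty}\bigr)}{\pi\, n_2\,(n_1-1)\cdots(n_1-n_2)},$$ where $c$ is a constant depending on $n_2$ and $\alpha$.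
   Context: $T_k(x)=\cos(k\arccos x)$ are the Chebyshev polynomials of the first kind. The $n_1$ Chebyshev points of the first kind are the zeros of $T_{n_1}$, i.e. $\cos\frac{(2j+1)\pi}{2n_1}$, $j=0,\ldots,n_1-1$. For positive integers $n_1,n_2$ with $n=n_1+n_2$, $\alpha\in[-1,1]$ and $I=[-1,1]\setminus\{\alpha\}$, set $$\mathbb{S}^{\alpha}_{n_1,n_2}(I):=\operatorname{span}\{x^j,\;x^k\log|x-\alpha| : j=0,\ldots,n_1-1,\;k=0,\ldots,n_2-1,\;x\in I\}.$$ Given interpolation points $\{x_0,\ldots,x_{n-1}\}\subset I$, the operator $\mathcal{S}^{\alpha}_{n_1,n_2}:C(I)\to\mathbb{S}^{\alpha}_{n_1,n_2}(I)$ maps $f\in C(I)$ to the function $\mathcal{S}^{\alpha}_{n_1,n_2}f\in\mathbb{S}^{\alpha}_{n_1,n_2}(I)$ with $(\mathcal{S}^{\alpha}_{n_1,n_2}f)(x_j)=f(x_j)$ for $j=0,\ldots,n-1$. It is assumed throughout that the points lie in $I$ and that this interpolation problem is uniquely solvable, so that the operator is well defined. Quadrature: write the interpolant as $$(\mathcal{S}^{\alpha}_{n_1,n_2}K)(x)=\sum_{j=0}^{n_1-1}a_jT_j(x)+\log|x-\alpha|\sum_{k=0}^{n_2-1}b_kT_k(x)$$ and define $$I_{n_1,n_2}[K]:=\sum_{j=0}^{n_1-1}a_j\,\xi_{1,j}+\sum_{j=0}^{n_2-1}b_j\,\xi_{2,j},\qquad \xi_{1,k}=\int_{-1}^1T_k(x)\,dx,\quad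 \xi_{2,k}=\int_{-1}^1T_k(x)\log|x-\alpha|\,dx .$$ Norms: $\|u\|_1:=\int_{-1}^1|u(t)|\,dt$ for $u\in L^1(I)$; $\|\cdot\|_\infty$ is the maximum (supremum) norm; and $$\|\mathcal{S}^{\alpha}_{n_1,n_2}\|_{1,\infty}:=\sup_{f\in C(I),\,\|f\|_\infty\ne0}\frac{\|\mathcal{S}^{\alpha}_{n_1,n_2}f\|_1}{\|f\|_\infty},$$ with the convention that $1/\|f\|_\infty$ is set to $0$ if the maximum norm of $f\in C(I)$ is unbounded. Here $C(I)$ denotes the continuous functions on $I$ (possibly unbounded).
   Formalization: The constant c may depend on g_1 and g_2 as well as on n_2 and α (it is uniform in n_1 and the interpolation points); with dependence on n_2 and α alone, replacing K by a large multiple of K violates the bound. *)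

theory Defs
  imports "HOL-Analysis.Analysis"
begin

definition cheb_T :: "nat \<Rightarrow> real \<Rightarrow> real" where
  "cheb_T k x = cos (real k * arccos x)"

definition cheb_points :: "nat \<Rightarrow> real set" where
  "cheb_points n = (\<lambda>j. cos (real (2 * j + 1) * pi / (2 * real n))) ` {..<n}"

definition punctured :: "real \<Rightarrow> real set" where
  "punctured \<alpha> = {-1..1} - {\<alpha>}"

text \<open>
  The span of the functions \<open>x^j\<close> and \<open>x^k log |x - \<alpha>|\<close> on the punctured interval. Its elements
  are extensional, so that equality of two elements means equality on the punctured interval.
\<close>

definition log_space :: "real \<Rightarrow> nat \<Rightarrow> nat \<Rightarrow> (real \<Rightarrow> real) set" where
  "log_space \<alpha> n1 n2 =
    {restrict (\<lambda>x. (\<Sum>j<n1. a j * x ^ j) + (\<Sum>k<n2. b k * (x ^ k * ln \<bar>x - \<alpha>\<bar>))) (punctured \<alpha>)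
      | a b :: nat \<Rightarrow> real. True}"

text \<open>
  \<open>C(I)\<close> is the set of total functions that are continuous on \<open>punctured \<alpha>\<close>; their values
  elsewhere are irrelevant below. \<open>X\<close> is the set of interpolation points.
\<close>

definition uniquely_solvable :: "real \<Rightarrow> nat \<Rightarrow> nat \<Rightarrow> real set \<Rightarrow> bool" where
  "uniquely_solvable \<alpha> n1 n2 X \<longleftrightarrow>
    (\<forall>f. continuous_on (punctured \<alpha>) f \<longrightarrow> (\<exists>!u. u \<in> log_space \<alpha> n1 n2 \<and> (\<forall>x\<in>X. u x = f x)))"

definition interp :: "real \<Rightarrow> nat \<Rightarrow> nat \<Rightarrow> real set \<Rightarrow> (real \<Rightarrow> real) \<Rightarrow> real \<Rightarrow> real" where
  "interp \<alpha> n1 n2 X f = (THE u. u \<in> log_space \<alpha> n1 n2 \<and> (\<forall>x\<in>X. u x = f x))"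

definition cheb_coeffs ::
  "real \<Rightarrow> nat \<Rightarrow> nat \<Rightarrow> (real \<Rightarrow> real) \<Rightarrow> (nat \<Rightarrow> real) \<times> (nat \<Rightarrow> real)" where
  "cheb_coeffs \<alpha> n1 n2 u = (SOME (a, b). \<forall>x\<in>punctured \<alpha>.
     u x = (\<Sum>j<n1. a j * cheb_T j x) + ln \<bar>x - \<alpha>\<bar> * (\<Sum>k<n2. b k * cheb_T k x))"

definition xi1 :: "nat \<Rightarrow> real" where
  "xi1 k = (LBINT x:{-1..1}. cheb_T k x)"

definition xi2 :: "real \<Rightarrow> nat \<Rightarrow> real" where
  "xi2 \<alpha> k = (LBINT x:{-1..1}. cheb_T k x * ln \<bar>x - \<alpha>\<bar>)"

definition quadrature :: "real \<Rightarrow> nat \<Rightarrow> nat \<Rightarrow> real set \<Rightarrow> (real \<Rightarrow> real) \<Rightarrow> real" where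
  "quadrature \<alpha> n1 n2 X K =
    (case cheb_coeffs \<alpha> n1 n2 (interp \<alpha> n1 n2 X K) of (a, b) \<Rightarrow>
      (\<Sum>j<n1. a j * xi1 j) + (\<Sum>j<n2. b j * xi2 \<alpha> j))"

definition norm1 :: "(real \<Rightarrow> real) \<Rightarrow> real" where
  "norm1 u = (LBINT t:{-1..1}. \<bar>u t\<bar>)"

definition sup_norm :: "real \<Rightarrow> (real \<Rightarrow> real) \<Rightarrow> ereal" where
  "sup_norm \<alpha> f = (SUP t\<in>punctured \<alpha>. ereal \<bar>f t\<bar>)"

text \<open>
  In \<open>ereal\<close>, \<open>1 / \<infinity> = 0\<close>, so unbounded \<open>f\<close> contribute the value 0. The supremum is taken over a
  set that is bounded above whenever the interpolation problem is uniquely solvable, because the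
  interpolant then depends linearly on finitely many values of \<open>f\<close>.
\<close>

definition op_norm_1_inf :: "real \<Rightarrow> nat \<Rightarrow> nat \<Rightarrow> real set \<Rightarrow> real" where
  "op_norm_1_inf \<alpha> n1 n2 X =
    (SUP f\<in>{f. continuous_on (punctured \<alpha>) f \<and> sup_norm \<alpha> f \<noteq> 0}.
      norm1 (interp \<alpha> n1 n2 X f) * real_of_ereal (1 / sup_norm \<alpha> f))"

text \<open>\<open>C\<^sup>\<infinity>\<close> on \<open>S\<close>; at the endpoints of an interval the derivatives are one-sided.\<close>

definition smooth_on :: "real set \<Rightarrow> (real \<Rightarrow> real) \<Rightarrow> bool" where
  "smooth_on S g \<longleftrightarrow> (\<exists>D :: nat \<Rightarrow> real \<Rightarrow> real. (\<forall>x\<in>S. D 0 x = g x) \<and>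
     (\<forall>k. \<forall>x\<in>S. (D k has_real_derivative D (Suc k) x) (at x within S)))"

end

theory Submission
  imports Defs "HOL-Real_Asymp.Real_Asymp"
begin

text \<open>
  The interpolation operator \<open>S\<close> is a linear projection onto \<open>log_space\<close>, so \<open>K - S K = w - S w\<close> with
  \<open>w = K - v\<close> for every \<open>v\<close> in that space, and the error is at most \<open>2 (1 + \<parallel>S\<parallel>) sup |w|\<close>. Write \<open>y = x - \<alpha>\<close> and \<open>g2 = p + y^n2 h\<close> with
  \<open>p\<close> the Taylor polynomial of degree \<open>n2 - 1\<close> at \<open>\<alpha>\<close>, and choose \<open>v = P + p ln |y|\<close>. It then suffices
  to approximate \<open>g1 + y^n2 h ln |y|\<close> uniformly by a polynomial \<open>P\<close> of degree below \<open>n1\<close> up to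
  \<open>O(n1^(- n2))\<close>. Its derivative has the same shape with \<open>n2 - 1\<close> in place of \<open>n2\<close>, so Jackson's
  inequality \<open>E_n f \<le> C / n E_(n-1) f'\<close> reduces this to \<open>n2 = 1\<close>. There \<open>ln |y|\<close> is replaced
  by \<open>ln (y^2 + \<epsilon>^2) / 2\<close> with \<open>\<epsilon> = 1 / n\<close>, which costs \<open>O(\<epsilon>)\<close> and yields a second
  derivative of size \<open>O(1 / \<epsilon>)\<close>.
\<close>

section \<open>Polynomial spans on \<open>[-1, 1]\<close> and the change between monomials and
  Chebyshev polynomials\<close>

text \<open>Membership constrains values on \<open>[-1, 1]\<close> only, because
  \<open>cheb_T\<close> is known to agree with a polynomial only where
  \<open>cos (arccos x) = x\<close>. The number \<open>n\<close> counts basis functions, so for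
  monomials the degree is below \<open>n\<close>.\<close>

definition span_on :: "(nat \<Rightarrow> real \<Rightarrow> real) \<Rightarrow> nat \<Rightarrow> (real \<Rightarrow> real) set" where
  "span_on B n = {p. \<exists>a. \<forall>x\<in>{-1..1}. p x = (\<Sum>j<n. a j * B j x)}"

lemma span_on_base: "j < n \<Longrightarrow> B j \<in> span_on B n"
  unfolding span_on_def
  by (auto intro!: exI[of _ "\<lambda>i. if i = j then 1 else 0"] simp: if_distrib[of "\<lambda>c. c * _"] cong: if_cong)

lemma span_on_scale: "p \<in> span_on B n \<Longrightarrow> (\<lambda>x. c * p x) \<in> span_on B n"
  unfolding span_on_def
proof safe
  fix a assume "\<forall>x\<in>{-1..1}. p x = (\<Sum>j<n. a j * B j x)"
  then show "\<exists>a. \<forall>x\<in>{-1..1}. c * p x = (\<Sum>j<n. a j * B j x)"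
    by (intro exI[of _ "\<lambda>j. c * a j"]) (simp add: sum_distrib_left mult.assoc)
qed

lemma span_on_add: "p \<in> span_on B n \<Longrightarrow> q \<in> span_on B n \<Longrightarrow> (\<lambda>x. p x + q x) \<in> span_on B n"
  unfolding span_on_def
proof safe
  fix a b assume "\<forall>x\<in>{-1..1}. p x = (\<Sum>j<n. a j * B j x)" "\<forall>x\<in>{-1..1}. q x = (\<Sum>j<n. b j * B j x)"
  then show "\<exists>a. \<forall>x\<in>{-1..1}. p x + q x = (\<Sum>j<n. a j * B j x)"
    by (intro exI[of _ "\<lambda>j. a j + b j"]) (simp add: sum.distrib algebra_simps)
qed

lemma span_on_zero: "(\<lambda>x. 0) \<in> span_on B n"
  unfolding span_on_def by (auto intro!: exI[of _ "\<lambda>_. 0"])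

lemma span_on_sum:
  "(\<And>i. i \<in> A \<Longrightarrow> p i \<in> span_on B n) \<Longrightarrow> (\<lambda>x. \<Sum>i\<in>A. p i x) \<in> span_on B n"
  by (induction A rule: infinite_finite_induct) (auto intro: span_on_zero span_on_add)

lemma span_on_cong:
  "p \<in> span_on B n \<Longrightarrow> (\<And>x. x \<in> {-1..1} \<Longrightarrow> q x = p x) \<Longrightarrow> q \<in> span_on B n"
  unfolding span_on_def by force

lemma span_on_mono:
  assumes "p \<in> span_on B m" "m \<le> n" shows "p \<in> span_on B n"
proof -
  obtain a where a: "\<forall>x\<in>{-1..1}. p x = (\<Sum>j<m. a j * B j x)"
    using assms(1) unfolding span_on_def by blast
  have "(\<lambda>x. \<Sum>j<m. a j * B j x) \<in> span_on B n"
    using assms(2) by (intro span_on_sum span_on_scale span_on_base) auto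
  then show ?thesis by (rule span_on_cong) (use a in auto)
qed

text \<open>Multiplication by \<open>c\<close> is linear, so checking it on the basis suffices. The
  constant 1 gives a change of basis, and \<open>c x = x\<close> gives multiplication by the
  variable.\<close>

lemma span_on_linear_image:
  assumes "p \<in> span_on B m" "\<And>j. j < m \<Longrightarrow> (\<lambda>x. c x * B j x) \<in> span_on C n"
  shows "(\<lambda>x. c x * p x) \<in> span_on C n"
proof -
  obtain a where a: "\<forall>x\<in>{-1..1}. p x = (\<Sum>j<m. a j * B j x)"
    using assms(1) unfolding span_on_def by blast
  have "(\<lambda>x. \<Sum>j<m. a j * (c x * B j x)) \<in> span_on C n"
    using assms(2) by (intro span_on_sum span_on_scale) auto
  then show ?thesis by (rule span_on_cong) (use a in \<open>auto simp: sum_distrib_left algebra_simps\<close>)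
qed

lemma span_on_trans:
  assumes "p \<in> span_on B m" "\<And>j. j < m \<Longrightarrow> B j \<in> span_on C n"
  shows "p \<in> span_on C n"
  using span_on_linear_image[OF assms(1), of "\<lambda>_. 1" C n] assms(2) by simp

abbreviation (input) monomials :: "nat \<Rightarrow> real \<Rightarrow> real" where
  "monomials \<equiv> \<lambda>j x. x ^ j"

text \<open>Sum-to-product formula for the angles \<open>(k + 2) t\<close> and \<open>k t\<close>
  with \<open>t = arccos x\<close>; the range of \<open>x\<close> gives
  \<open>cos t = x\<close>.\<close>

lemma cheb_T_recurrence:
  assumes "x \<in> {-1..1}"
  shows "x * cheb_T (Suc k) x = (cheb_T (Suc (Suc k)) x + cheb_T k x) / 2"
proof -
  have "cos (real (Suc (Suc k)) * arccos x) + cos (real k * arccos x)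
      = 2 * cos (real (Suc k) * arccos x) * cos (arccos x)"
    by (simp add: cos_plus_cos algebra_simps add_divide_distrib)
  then show ?thesis using assms by (simp add: cheb_T_def)
qed

lemma cheb_T_0: "cheb_T 0 x = 1"
  and cheb_T_1: "x \<in> {-1..1} \<Longrightarrow> cheb_T (Suc 0) x = x"
  by (auto simp: cheb_T_def)

lemma span_on_monomials_times:
  "p \<in> span_on monomials n \<Longrightarrow> (\<lambda>x. x * p x) \<in> span_on monomials (Suc n)"
  by (rule span_on_linear_image) (use span_on_base[of "Suc _" "Suc n" monomials] in auto)

text \<open>The three-term recurrence reaches back two indices, hence the strong induction with two
  base cases.\<close>

lemma cheb_T_in_monomials: "cheb_T k \<in> span_on monomials (Suc k)"
proof (induction k rule: less_induct)
  case (less k)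
  consider "k = 0" | "k = 1" | l where "k = Suc (Suc l)"
    by (metis One_nat_def nat.exhaust)
  then show ?case
  proof cases
    case 1
    then show ?thesis
      by (auto intro: span_on_cong[OF span_on_base[of 0]] simp: cheb_T_0)
  next
    case 2
    then show ?thesis
      by (auto intro: span_on_cong[OF span_on_base[of 1]] simp: cheb_T_1)
  next
    case 3
    have "(\<lambda>x. 2 * (x * cheb_T (Suc l) x) + (- 1) * cheb_T l x) \<in> span_on monomials (Suc k)"
      using less[of "Suc l"] less[of l] 3
      by (intro span_on_add span_on_scale span_on_monomials_times)
         (auto intro: span_on_mono)
    then show ?thesis
      by (rule span_on_cong) (use 3 in \<open>simp add: cheb_T_recurrence add_divide_distrib\<close>)
  qed
qed

lemma span_on_cheb_T_times:
  assumes "p \<in> span_on cheb_T n"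
  shows "(\<lambda>x. x * p x) \<in> span_on cheb_T (Suc n)"
  using assms
proof (rule span_on_linear_image)
  fix j assume j: "j < n"
  show "(\<lambda>x. x * cheb_T j x) \<in> span_on cheb_T (Suc n)"
  proof (cases j)
    case 0
    then show ?thesis using j
      by (auto intro!: span_on_cong[OF span_on_base[of 1]] simp: cheb_T_0 cheb_T_1)
  next
    case (Suc l)
    have "(\<lambda>x. 1 / 2 * cheb_T (Suc (Suc l)) x + 1 / 2 * cheb_T l x) \<in> span_on cheb_T (Suc n)"
      using Suc j by (intro span_on_add span_on_scale span_on_base) auto
    then show ?thesis by (rule span_on_cong) (use Suc in \<open>simp add: cheb_T_recurrence add_divide_distrib\<close>)
  qed
qed

text \<open>Multiplication by \<open>x\<close> enlarges the Chebyshev span by one index. This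
  inclusion later supplies the Chebyshev coefficients of an interpolant.\<close>

lemma monomial_in_cheb_T: "(\<lambda>x. x ^ k) \<in> span_on cheb_T (Suc k)"
proof (induction k)
  case 0
  show ?case by (rule span_on_cong[OF span_on_base[of 0]]) (auto simp: cheb_T_0)
next
  case (Suc k)
  then show ?case using span_on_cheb_T_times[OF Suc] by simp
qed

lemma monomials_subset_cheb_T: "p \<in> span_on monomials n \<Longrightarrow> p \<in> span_on cheb_T n"
  by (erule span_on_trans) (rule span_on_mono[OF monomial_in_cheb_T], auto)

lemma cheb_T_subset_monomials: "p \<in> span_on cheb_T n \<Longrightarrow> p \<in> span_on monomials n"
  by (erule span_on_trans) (rule span_on_mono[OF cheb_T_in_monomials], auto)

section \<open>Jackson's inequality for Lipschitz functions\<close>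

text \<open>Multiplication by \<open>2 sin (\<delta> / 2)\<close> makes the sum telescope, and the
  two ends \<open>S 0\<close> and \<open>S N\<close> agree by periodicity. The multiplier is nonzero
  because \<open>N\<close> does not divide \<open>d\<close> when
  \<open>0 < \<bar>d\<bar> < N\<close>.\<close>

lemma sum_cos_equispaced:
  fixes d :: int
  assumes "N > 0" "d \<noteq> 0" "\<bar>d\<bar> < int N"
  shows "(\<Sum>j<N. cos (d * (\<theta> - 2 * pi * real j / real N))) = 0"
proof -
  define \<delta> where "\<delta> = 2 * pi * d / real N"
  have N: "real N * \<delta> = 2 * pi * d" using assms by (simp add: \<delta>_def)
  have s: "sin (\<delta> / 2) \<noteq> 0"
  proof
    assume "sin (\<delta> / 2) = 0"
    then obtain i :: int where "\<delta> / 2 = i * pi" by (auto simp: sin_zero_iff_int2)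
    then have "real_of_int d = real_of_int (i * int N)"
      using assms(1) by (simp add: \<delta>_def field_simps)
    then have "d = i * int N" by linarith
    then show False using assms zdvd_not_zless[of "\<bar>d\<bar>" "int N"] dvd_triv_right[of "int N" i]
      by auto
  qed
  define S where "S j = sin (d * \<theta> - real j * \<delta> + \<delta> / 2)" for j
  have "2 * sin (\<delta> / 2) * (\<Sum>j<N. cos (d * (\<theta> - 2 * pi * real j / real N)))
      = (\<Sum>j<N. S j - S (Suc j))"
    unfolding sum_distrib_left
  proof (rule sum.cong[OF refl])
    fix j
    have "d * (\<theta> - 2 * pi * real j / real N) = d * \<theta> - real j * \<delta>"
      by (simp add: \<delta>_def algebra_simps)
    moreover have "S (Suc j) = sin (d * \<theta> - real j * \<delta> - \<delta> / 2)"
      by (simp add: S_def algebra_simps)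
    ultimately show "2 * sin (\<delta> / 2) * cos (d * (\<theta> - 2 * pi * real j / real N)) = S j - S (Suc j)"
      by (simp add: S_def sin_add sin_diff)
  qed
  also have "\<dots> = S 0 - S N" by (rule sum_lessThan_telescope')
  also have "S N = S 0"
    unfolding S_def N by (simp add: sin_diff sin_add cos_diff cos_add)
  finally show ?thesis using s by simp
qed

lemma sum_cos_equispaced_all:
  fixes d :: int
  assumes "N > 0" "\<bar>d\<bar> < int N"
  shows "(\<Sum>j<N. cos (d * (\<theta> - 2 * pi * real j / real N))) = (if d = 0 then real N else 0)"
  using sum_cos_equispaced[OF assms(1) _ assms(2)] by simp

text \<open>
  The (unnormalised) Fejer-Korovkin kernel. With these weights the two neighbours of \<open>a_l\<close> add up to
  \<open>2 cos (\<pi> / (n + 1)) a_l\<close>, so after normalisation the kernel, sampled at equispaced nodes, integrates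
  \<open>1 - cos t\<close> to \<open>1 - cos (\<pi> / (n + 1)) = O(1 / n^2)\<close>, which is the rate in Jackson's inequality.
\<close>

definition korovkin_coeff :: "nat \<Rightarrow> nat \<Rightarrow> real" where
  "korovkin_coeff n l = sin (real (Suc l) * pi / real (Suc n))"

definition korovkin_kernel :: "nat \<Rightarrow> real \<Rightarrow> real" where
  "korovkin_kernel n t = (\<Sum>l<n. \<Sum>m<n. korovkin_coeff n l * korovkin_coeff n m *
      cos (of_int (int l - int m) * t))"

definition korovkin_mass :: "nat \<Rightarrow> real" where
  "korovkin_mass n = (\<Sum>l<n. (korovkin_coeff n l)\<^sup>2)"

text \<open>The kernel is the squared modulus of the trigonometric polynomial with coefficients
  \<open>korovkin_coeff n l\<close> at the frequencies \<open>l < n\<close>, split here into its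
  cosine and sine parts.\<close>

lemma korovkin_kernel_nonneg: "korovkin_kernel n t \<ge> 0"
proof -
  have "korovkin_kernel n t = (\<Sum>l<n. korovkin_coeff n l * cos (real l * t))\<^sup>2
      + (\<Sum>l<n. korovkin_coeff n l * sin (real l * t))\<^sup>2"
    unfolding korovkin_kernel_def power2_eq_square sum_product sum.distrib[symmetric]
    by (intro sum.cong refl) (simp add: cos_diff algebra_simps)
  then show ?thesis by simp
qed

lemma korovkin_mass_pos:
  assumes "n \<ge> 1" shows "korovkin_mass n > 0"
proof -
  have "korovkin_coeff n 0 > 0"
    using assms unfolding korovkin_coeff_def
    by (intro sin_gt_zero) (auto simp: field_simps)
  then show ?thesis unfolding korovkin_mass_def
    using assms by (intro sum_pos2[of _ 0]) auto
qed

lemma sum_double_diagonal: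
  fixes c :: "nat \<Rightarrow> nat \<Rightarrow> real"
  shows "(\<Sum>l<n. \<Sum>m<n. c l m * (if int l - int m = 0 then r else 0)) = r * (\<Sum>l<n. c l l)"
proof -
  have "(\<Sum>l<n. \<Sum>m<n. c l m * (if int l - int m = 0 then r else 0))
      = (\<Sum>l<n. \<Sum>m<n. if m = l then c l m * r else 0)"
    by (intro sum.cong refl) auto
  also have "\<dots> = (\<Sum>l<n. c l l * r)" by (intro sum.cong refl) simp
  finally show ?thesis by (simp add: sum_distrib_left mult.commute)
qed

lemma sum_rotate:
  fixes F :: "'a \<Rightarrow> 'b \<Rightarrow> 'c \<Rightarrow> 'd::comm_monoid_add"
  shows "(\<Sum>j\<in>A. \<Sum>l\<in>B. \<Sum>m\<in>C. F j l m) = (\<Sum>l\<in>B. \<Sum>m\<in>C. \<Sum>j\<in>A. F j l m)"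
  by (subst sum.swap) (intro sum.cong refl, rule sum.swap)

text \<open>All frequencies \<open>l - m\<close> are below \<open>N\<close> in modulus, so
  orthogonality at the nodes leaves only the diagonal \<open>l = m\<close>.\<close>

lemma sum_korovkin_kernel:
  assumes "N > n"
  shows "(\<Sum>j<N. korovkin_kernel n (\<theta> - 2 * pi * real j / real N)) = real N * korovkin_mass n"
proof -
  have "(\<Sum>j<N. korovkin_kernel n (\<theta> - 2 * pi * real j / real N))
      = (\<Sum>l<n. \<Sum>m<n. korovkin_coeff n l * korovkin_coeff n m *
          (\<Sum>j<N. cos (of_int (int l - int m) * (\<theta> - 2 * pi * real j / real N))))"
    unfolding korovkin_kernel_def sum_distrib_left
    by (rule sum_rotate)
  also have "\<dots> = (\<Sum>l<n. \<Sum>m<n. korovkin_coeff n l * korovkin_coeff n m *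
          (if int l - int m = 0 then real N else 0))"
    using assms by (intro sum.cong refl, subst sum_cos_equispaced_all) auto
  also have "\<dots> = real N * korovkin_mass n"
    unfolding sum_double_diagonal korovkin_mass_def by (simp add: power2_eq_square)
  finally show ?thesis .
qed

text \<open>The coefficients form an eigenvector of the adjacency matrix of a path: \<open>sin (a -
  \<delta>) + sin (a + \<delta>) = 2 cos \<delta> sin a\<close>. The relation also holds at both
  ends, where the missing neighbours would be \<open>sin 0\<close> and
  \<open>sin pi\<close>.\<close>

lemma korovkin_coeff_neighbours:
  "(\<Sum>l<n. \<Sum>m<n. korovkin_coeff n l * korovkin_coeff n m *
      ((if int l - int m = 1 then 1 else 0) + (if int l - int m = - 1 then 1 else 0)))
    = 2 * cos (pi / real (Suc n)) * korovkin_mass n"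
proof -
  define a where "a = korovkin_coeff n"
  have neighbours: "(\<Sum>m<n. a m * ((if int l - int m = 1 then 1 else 0) + (if int l - int m = - 1 then 1 else 0)))
      = 2 * cos (pi / real (Suc n)) * a l" if l: "l < n" for l
  proof -
    have "(\<Sum>m<n. a m * (if int l - int m = 1 then 1 else 0)) = sin (real l * pi / real (Suc n))"
    proof (cases l)
      case (Suc k)
      have "(\<Sum>m<n. a m * (if int l - int m = 1 then 1 else 0)) = (\<Sum>m<n. if m = k then a m else 0)"
        by (intro sum.cong) (auto simp: Suc)
      also have "\<dots> = a k" using l Suc by simp
      finally show ?thesis by (simp add: Suc a_def korovkin_coeff_def)
    qed (auto intro!: sum.neutral)
    moreover have "(\<Sum>m<n. a m * (if int l - int m = - 1 then 1 else 0))
        = sin (real (Suc (Suc l)) * pi / real (Suc n))"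
    proof -
      have "(\<Sum>m<n. a m * (if int l - int m = - 1 then 1 else 0)) = (\<Sum>m<n. if m = Suc l then a m else 0)"
        by (intro sum.cong) auto
      also have "\<dots> = (if Suc l < n then a (Suc l) else 0)" by simp
      also have "\<dots> = a (Suc l)"
      proof (cases "Suc l < n")
        case False
        then have "n = Suc l" using l by simp
        then have "a (Suc l) = 0" unfolding a_def korovkin_coeff_def by simp
        then show ?thesis using False by simp
      qed simp
      finally show ?thesis by (simp add: a_def korovkin_coeff_def)
    qed
    moreover have "sin (real l * pi / real (Suc n)) + sin (real (Suc (Suc l)) * pi / real (Suc n))
        = 2 * cos (pi / real (Suc n)) * a l"
    proof -
      define \<delta> where "\<delta> = pi / real (Suc n)"
      have "real l * pi / real (Suc n) = real (Suc l) * \<delta> - \<delta>"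
        "real (Suc (Suc l)) * pi / real (Suc n) = real (Suc l) * \<delta> + \<delta>"
        "a l = sin (real (Suc l) * \<delta>)"
        by (simp_all add: \<delta>_def a_def korovkin_coeff_def distrib_right add_divide_distrib)
      then show ?thesis unfolding \<delta>_def[symmetric] by (simp add: sin_add sin_diff)
    qed
    ultimately show ?thesis by (simp add: distrib_left sum.distrib)
  qed
  have "(\<Sum>l<n. \<Sum>m<n. a l * a m *
      ((if int l - int m = 1 then 1 else 0) + (if int l - int m = - 1 then 1 else 0)))
    = (\<Sum>l<n. a l * (2 * cos (pi / real (Suc n)) * a l))"
  proof (intro sum.cong refl)
    fix l assume "l \<in> {..<n}"
    then have "a l * (2 * cos (pi / real (Suc n)) * a l) = a l * (\<Sum>m<n. a m *
      ((if int l - int m = 1 then 1 else 0) + (if int l - int m = - 1 then 1 else 0)))"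
      using neighbours[of l] by simp
    then show "(\<Sum>m<n. a l * a m *
      ((if int l - int m = 1 then 1 else 0) + (if int l - int m = - 1 then 1 else 0)))
      = a l * (2 * cos (pi / real (Suc n)) * a l)"
      by (simp add: sum_distrib_left mult.assoc)
  qed
  then show ?thesis
    by (simp add: a_def korovkin_mass_def sum_distrib_left power2_eq_square algebra_simps)
qed

text \<open>The factor \<open>cos t\<close> shifts each frequency by one either way, so
  orthogonality now selects the pairs with \<open>l - m\<close> equal to 1 or -1. The shifted
  frequencies are at most \<open>n\<close> in modulus, which is why \<open>N > n\<close> is still
  enough.\<close>

lemma sum_korovkin_kernel_cos:
  assumes "N > n"
  shows "(\<Sum>j<N. korovkin_kernel n (\<theta> - 2 * pi * real j / real N) * cos (\<theta> - 2 * pi * real j / real N))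
    = real N * cos (pi / real (Suc n)) * korovkin_mass n"
proof -
  define t where "t j = \<theta> - 2 * pi * real j / real N" for j
  have split: "cos (of_int d * s) * cos s = (cos (of_int (d - 1) * s) + cos (of_int (d + 1) * s)) / 2"
    for d :: int and s :: real
    by (simp add: left_diff_distrib distrib_right cos_diff cos_add)
  have "(\<Sum>j<N. korovkin_kernel n (t j) * cos (t j))
      = (\<Sum>l<n. \<Sum>m<n. korovkin_coeff n l * korovkin_coeff n m *
          (\<Sum>j<N. cos (of_int (int l - int m) * t j) * cos (t j)))"
    unfolding korovkin_kernel_def sum_distrib_left sum_distrib_right
    by (subst sum_rotate) (simp add: mult.assoc)
  also have "\<dots> = (\<Sum>l<n. \<Sum>m<n. korovkin_coeff n l * korovkin_coeff n m *
          ((if int l - int m = 1 then 1 else 0) + (if int l - int m = - 1 then 1 else 0))) * (real N / 2)"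
    unfolding sum_distrib_right
  proof (intro sum.cong refl)
    fix l m assume "l \<in> {..<n}" "m \<in> {..<n}"
    then have "(\<Sum>j<N. cos (of_int (int l - int m - 1) * t j)) = (if int l - int m - 1 = 0 then real N else 0)"
      "(\<Sum>j<N. cos (of_int (int l - int m + 1) * t j)) = (if int l - int m + 1 = 0 then real N else 0)"
      unfolding t_def using assms by (intro sum_cos_equispaced_all; auto)+
    then show "korovkin_coeff n l * korovkin_coeff n m *
          (\<Sum>j<N. cos (of_int (int l - int m) * t j) * cos (t j)) =
        korovkin_coeff n l * korovkin_coeff n m *
          ((if int l - int m = 1 then 1 else 0) + (if int l - int m = - 1 then 1 else 0)) * (real N / 2)"
      unfolding split sum_divide_distrib[symmetric] sum.distrib by auto
  qed
  finally show ?thesis unfolding korovkin_coeff_neighbours t_def by simp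
qed

text \<open>Averaging over the two angles with cosine \<open>x\<close> cancels the sine terms. What
  remains involves \<open>cos (d * arccos x)\<close>, a Chebyshev polynomial of degree
  \<open>\<bar>d\<bar>\<close> since cosine is even.\<close>

lemma korovkin_kernel_even_part:
  assumes "x \<in> {-1..1}"
  shows "(korovkin_kernel n (arccos x - s) + korovkin_kernel n (- arccos x - s)) / 2
    = (\<Sum>l<n. \<Sum>m<n. korovkin_coeff n l * korovkin_coeff n m * cos (of_int (int l - int m) * s)
        * cheb_T (nat \<bar>int l - int m\<bar>) x)"
proof -
  have *: "cos (of_int d * (arccos x - s)) + cos (of_int d * (- arccos x - s))
      = 2 * (cos (of_int d * s) * cheb_T (nat \<bar>d\<bar>) x)" for d :: int
  proof -
    have "cos (of_int d * arccos x) = cheb_T (nat \<bar>d\<bar>) x"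
      unfolding cheb_T_def by (cases "d \<ge> 0") (auto simp: abs_if)
    then show ?thesis by (simp add: cos_diff cos_add algebra_simps)
  qed
  have "korovkin_kernel n (arccos x - s) + korovkin_kernel n (- arccos x - s)
    = (\<Sum>l<n. \<Sum>m<n. korovkin_coeff n l * korovkin_coeff n m *
        (cos (of_int (int l - int m) * (arccos x - s)) + cos (of_int (int l - int m) * (- arccos x - s))))"
    unfolding korovkin_kernel_def by (simp add: sum.distrib distrib_left)
  then show ?thesis unfolding * by (simp add: sum_distrib_left mult.assoc sum_divide_distrib)
qed

lemma one_minus_cos: "1 - cos t = 2 * (sin (t / 2))\<^sup>2" for t :: real
  using cos_double_sin[of "t / 2"] by simp

section \<open>Jackson's inequality and its integrated form\<close>

text \<open>Discrete convolution of \<open>f (cos \<theta>)\<close> with the kernel at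
  \<open>n + 1\<close> nodes. The normalised weights are nonnegative with sum 1, so the error is at
  most a weighted mean of Lipschitz bounds, which the cosine moment \<open>cos \<delta>\<close> of
  the weights controls.\<close>

lemma jackson_lipschitz:
  fixes f :: "real \<Rightarrow> real"
  assumes n: "n \<ge> 1" and L: "L \<ge> 0"
    and lip: "\<And>x y. x \<in> {-1..1} \<Longrightarrow> y \<in> {-1..1} \<Longrightarrow> \<bar>f x - f y\<bar> \<le> L * \<bar>x - y\<bar>"
  shows "\<exists>p\<in>span_on monomials n. \<forall>x\<in>{-1..1}. \<bar>f x - p x\<bar> \<le> L * pi / real (Suc n)"
proof -
  define N where "N = Suc n"
  define s where "s j = 2 * pi * real j / real N" for j
  define M where "M = real N * korovkin_mass n"
  define \<delta> where "\<delta> = pi / real (Suc n)"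
  have nN: "n < N" by (simp add: N_def)
  have Mpos: "M > 0" using korovkin_mass_pos[OF n] by (simp add: M_def N_def)
  have \<delta>: "\<delta> > 0" by (simp add: \<delta>_def)
  define Q where "Q \<theta> = (\<Sum>j<N. f (cos (s j)) * korovkin_kernel n (\<theta> - s j)) / M" for \<theta>
  \<comment> \<open>only the even part of \<open>Q\<close> is a polynomial in \<open>cos \<theta>\<close>\<close>
  define p where "p x = (Q (arccos x) + Q (- arccos x)) / 2" for x
  have "(\<lambda>x. 1 / M * (\<Sum>j<N. f (cos (s j)) * (\<Sum>l<n. \<Sum>m<n. korovkin_coeff n l * korovkin_coeff n m *
      cos (of_int (int l - int m) * s j) * cheb_T (nat \<bar>int l - int m\<bar>) x))) \<in> span_on cheb_T n"
    by (intro span_on_scale span_on_sum span_on_base) auto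
  then have "p \<in> span_on cheb_T n"
  proof (rule span_on_cong)
    fix x :: real assume x: "x \<in> {-1..1}"
    have "p x = 1 / M * (\<Sum>j<N. f (cos (s j)) *
        ((korovkin_kernel n (arccos x - s j) + korovkin_kernel n (- arccos x - s j)) / 2))"
      unfolding p_def Q_def
      by (simp add: add_divide_distrib[symmetric] sum.distrib[symmetric] distrib_left[symmetric]
            sum_divide_distrib[symmetric])
    then show "p x = 1 / M * (\<Sum>j<N. f (cos (s j)) * (\<Sum>l<n. \<Sum>m<n. korovkin_coeff n l * korovkin_coeff n m *
      cos (of_int (int l - int m) * s j) * cheb_T (nat \<bar>int l - int m\<bar>) x))"
      unfolding korovkin_kernel_even_part[OF x] .
  qed
  then have "p \<in> span_on monomials n" by (rule cheb_T_subset_monomials)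
  moreover have Q: "\<bar>f (cos \<theta>) - Q \<theta>\<bar> \<le> L * \<delta>" for \<theta>
  proof -
    define w where "w j = korovkin_kernel n (\<theta> - s j) / M" for j
    have w0: "w j \<ge> 0" for j using Mpos korovkin_kernel_nonneg by (simp add: w_def)
    have w1: "(\<Sum>j<N. w j) = 1"
      using sum_korovkin_kernel[OF nN, of \<theta>, folded M_def] Mpos
      unfolding w_def sum_divide_distrib[symmetric] s_def by simp
    have wc: "(\<Sum>j<N. w j * cos (\<theta> - s j)) = cos \<delta>"
      using sum_korovkin_kernel_cos[OF nN, of \<theta>] Mpos
      unfolding w_def times_divide_eq_left sum_divide_distrib[symmetric] s_def
      by (auto simp: M_def \<delta>_def zero_less_mult_iff)
    \<comment> \<open>With \<open>u = \<bar>2 sin ((\<theta> - s j) / 2)\<bar>\<close> one has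
      \<open>u\<^sup>2 = 2 (1 - cos (\<theta> - s j))\<close>. The inequality
      \<open>2 u \<delta> \<le> u\<^sup>2 + \<delta>\<^sup>2\<close> trades \<open>u\<close> for
      \<open>u\<^sup>2\<close>, so that only the two known moments of the weights enter.\<close>
    have bound: "\<bar>f (cos \<theta>) - f (cos (s j))\<bar> \<le> L * ((1 - cos (\<theta> - s j)) / \<delta> + \<delta> / 2)" for j
    proof -
      define u where "u = \<bar>2 * sin ((\<theta> - s j) / 2)\<bar>"
      have "\<bar>cos \<theta> - cos (s j)\<bar> = u * \<bar>sin ((\<theta> + s j) / 2)\<bar>"
      proof -
        have "(s j - \<theta>) / 2 = - ((\<theta> - s j) / 2)" by (simp add: field_simps)
        then have "cos \<theta> - cos (s j) = - (2 * sin ((\<theta> - s j) / 2) * sin ((\<theta> + s j) / 2))"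
          unfolding cos_diff_cos by (simp only: sin_minus mult_minus_right mult.commute mult.left_commute)
        then show ?thesis by (simp only: u_def abs_mult abs_minus)
      qed
      also have "\<dots> \<le> u" using abs_sin_le_one by (simp add: u_def mult_left_le)
      finally have 1: "\<bar>f (cos \<theta>) - f (cos (s j))\<bar> \<le> L * u"
        using lip[of "cos \<theta>" "cos (s j)"] L
        by (smt (verit) atLeastAtMost_iff cos_ge_minus_one cos_le_one mult_left_mono)
      have "u\<^sup>2 = 2 * (1 - cos (\<theta> - s j))"
        by (simp add: u_def power_mult_distrib one_minus_cos)
      moreover have "2 * u * \<delta> \<le> u\<^sup>2 + \<delta>\<^sup>2" using sum_squares_bound by blast
      ultimately have "u \<le> (1 - cos (\<theta> - s j)) / \<delta> + \<delta> / 2"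
        using \<delta> by (simp add: field_simps power2_eq_square)
      then show ?thesis using 1 L by (meson mult_left_mono order_trans)
    qed
    have "f (cos \<theta>) - Q \<theta> = (\<Sum>j<N. w j * (f (cos \<theta>) - f (cos (s j))))"
    proof -
      have "Q \<theta> = (\<Sum>j<N. w j * f (cos (s j)))"
        by (simp add: Q_def w_def sum_divide_distrib mult.commute)
      moreover have "f (cos \<theta>) = (\<Sum>j<N. w j * f (cos \<theta>))"
        by (simp only: sum_distrib_right[symmetric] w1 mult_1)
      ultimately show ?thesis by (simp add: right_diff_distrib sum_subtractf)
    qed
    also have "\<bar>\<dots>\<bar> \<le> (\<Sum>j<N. w j * \<bar>f (cos \<theta>) - f (cos (s j))\<bar>)"
      using w0 by (intro order_trans[OF sum_abs]) (simp add: abs_mult)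
    also have "\<dots> \<le> (\<Sum>j<N. w j * (L * ((1 - cos (\<theta> - s j)) / \<delta> + \<delta> / 2)))"
      using w0 bound by (intro sum_mono mult_left_mono) auto
    also have "\<dots> = L * (((\<Sum>j<N. w j) - (\<Sum>j<N. w j * cos (\<theta> - s j))) / \<delta> + (\<Sum>j<N. w j) * \<delta> / 2)"
      unfolding sum_subtractf[symmetric] sum_distrib_right sum_divide_distrib sum.distrib[symmetric] sum_distrib_left
      by (intro sum.cong refl) (simp add: field_simps)
    also have "\<dots> = L * ((1 - cos \<delta>) / \<delta> + \<delta> / 2)" by (simp add: w1 wc)
    \<comment> \<open>Since \<open>1 - cos \<delta> \<le> \<delta>\<^sup>2 / 2\<close>, each of the
      two terms is at most \<open>\<delta> / 2\<close>; the choice of \<open>\<delta>\<close>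
      balances them.\<close>
    also have "\<dots> \<le> L * \<delta>"
    proof -
      have "1 - cos \<delta> = 2 * (sin (\<delta> / 2))\<^sup>2" by (rule one_minus_cos)
      also have "(sin (\<delta> / 2))\<^sup>2 \<le> (\<delta> / 2)\<^sup>2"
        using abs_sin_x_le_abs_x abs_le_square_iff by blast
      finally have "(1 - cos \<delta>) / \<delta> + \<delta> / 2 \<le> \<delta>"
        using \<delta> by (simp add: field_simps power2_eq_square)
      then show ?thesis using L by (rule mult_left_mono)
    qed
    finally show ?thesis .
  qed
  \<comment> \<open>Both angles \<open>arccos x\<close> and \<open>- arccos x\<close> have cosine
    \<open>x\<close>, so the mean \<open>p x\<close> inherits the bound for
    \<open>Q\<close>.\<close>
  have "\<bar>f x - p x\<bar> \<le> L * \<delta>" if "x \<in> {-1..1}" for x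
    using Q[of "arccos x"] Q[of "- arccos x"] that by (simp add: p_def field_simps abs_le_iff)
  ultimately show ?thesis unfolding \<delta>_def by force
qed

text \<open>For an antiderivative \<open>P\<close> of \<open>p\<close>, the mean value inequality
  gives \<open>f - P\<close> the Lipschitz constant \<open>e\<close>, and Jackson's inequality
  applies to this difference. Integration costs one degree.\<close>

lemma jackson_integrate:
  fixes f :: "real \<Rightarrow> real"
  assumes p: "p \<in> span_on monomials n" and e: "\<And>x. x \<in> {-1..1} \<Longrightarrow> \<bar>f' x - p x\<bar> \<le> e"
    and f: "\<And>x. x \<in> {-1..1} \<Longrightarrow> (f has_real_derivative f' x) (at x within {-1..1})"
  shows "\<exists>q\<in>span_on monomials (Suc n). \<forall>x\<in>{-1..1}. \<bar>f x - q x\<bar> \<le> e * pi / real (Suc (Suc n))"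
proof -
  obtain a where a: "\<And>x. x \<in> {-1..1} \<Longrightarrow> p x = (\<Sum>j<n. a j * x ^ j)"
    using p unfolding span_on_def by auto
  define P where "P x = (\<Sum>j<n. a j / real (Suc j) * x ^ Suc j)" for x
  have P: "P \<in> span_on monomials (Suc n)"
    unfolding P_def by (intro span_on_sum span_on_scale span_on_base) auto
  have dP: "(P has_real_derivative p x) (at x within {-1..1})" if "x \<in> {-1..1}" for x
    unfolding P_def a[OF that]
  proof (rule DERIV_sum)
    fix j
    have "((\<lambda>x. a j / real (Suc j) * x ^ Suc j) has_real_derivative
        a j / real (Suc j) * (real (Suc j) * x ^ (Suc j - Suc 0))) (at x within {-1..1})"
      by (intro DERIV_cmult DERIV_pow)
    then show "((\<lambda>x. a j / real (Suc j) * x ^ Suc j) has_real_derivative a j * x ^ j) (at x within {-1..1})"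
      by (simp del: of_nat_Suc power_Suc)
  qed
  have e0: "e \<ge> 0" using e[of 0] by (simp add: order_trans[OF abs_ge_zero])
  have lip: "\<bar>(f x - P x) - (f y - P y)\<bar> \<le> e * \<bar>x - y\<bar>" if "x \<in> {-1..1}" "y \<in> {-1..1}" for x y
  proof -
    have "norm ((f x - P x) - (f y - P y)) \<le> e * norm (x - y)"
    proof (rule field_differentiable_bound[OF _ _ _ that])
      fix z :: real assume z: "z \<in> {-1..1}"
      show "((\<lambda>x. f x - P x) has_field_derivative f' z - p z) (at z within {-1..1})"
        using f[OF z] dP[OF z] by (rule DERIV_diff)
      show "norm (f' z - p z) \<le> e" using e[OF z] by simp
    qed simp
    then show ?thesis by simp
  qed
  obtain q where q: "q \<in> span_on monomials (Suc n)"
    "\<forall>x\<in>{-1..1}. \<bar>(f x - P x) - q x\<bar> \<le> e * pi / real (Suc (Suc n))"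
    using jackson_lipschitz[of "Suc n" e "\<lambda>x. f x - P x"] e0 lip by auto
  show ?thesis
    using span_on_add[OF P q(1)] q(2) by (intro bexI[of _ "\<lambda>x. P x + q x"]) (auto simp: algebra_simps)
qed

section \<open>Smooth functions and the logarithmic singularity\<close>

lemma DERIV_chain_within:
  assumes "(f has_real_derivative D) (at (g x) within T)" "(g has_real_derivative E) (at x within S)"
    and "\<And>x. x \<in> S \<Longrightarrow> g x \<in> T"
  shows "((\<lambda>x. f (g x)) has_real_derivative D * E) (at x within S)"
  using DERIV_image_chain[OF DERIV_subset[OF assms(1)] assms(2)] assms(3) by (auto simp: o_def)

lemma smooth_onE:
  assumes "smooth_on S g"
  obtains g' where "smooth_on S g'" "\<And>x. x \<in> S \<Longrightarrow> (g has_real_derivative g' x) (at x within S)"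
proof -
  obtain D where D: "\<forall>x\<in>S. D 0 x = g x"
    "\<forall>k. \<forall>x\<in>S. (D k has_real_derivative D (Suc k) x) (at x within S)"
    using assms unfolding smooth_on_def by blast
  show ?thesis
  proof (rule that[of "D 1"])
    show "smooth_on S (D 1)"
      unfolding smooth_on_def by (intro exI[of _ "\<lambda>k. D (Suc k)"]) (use D in auto)
    fix x assume "x \<in> S"
    then show "(g has_real_derivative D 1 x) (at x within S)"
      using has_derivative_transform[of x S g "D 0"] D unfolding has_field_derivative_def One_nat_def by auto
  qed
qed

lemma smooth_on_continuous: "smooth_on S g \<Longrightarrow> continuous_on S g"
  by (erule smooth_onE) (auto intro: DERIV_continuous simp: continuous_on_eq_continuous_within)

lemma smooth_on_bounded:
  fixes a b :: real
  assumes "smooth_on {a..b} g"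
  obtains B where "B \<ge> 0" "\<And>x. x \<in> {a..b} \<Longrightarrow> \<bar>g x\<bar> \<le> B"
proof -
  have "bounded (g ` {a..b})"
    using assms by (intro compact_imp_bounded compact_continuous_image smooth_on_continuous) auto
  then obtain B where "\<And>x. x \<in> {a..b} \<Longrightarrow> \<bar>g x\<bar> \<le> B" unfolding bounded_iff by (auto simp del: atLeastAtMost_iff)
  then show ?thesis using that[of "max B 0"] by (meson max.cobounded1 max.cobounded2 order_trans)
qed

lemma smooth_on_add:
  assumes "smooth_on S f" "smooth_on S g" shows "smooth_on S (\<lambda>x. f x + g x)"
proof -
  obtain D E where "\<forall>x\<in>S. D 0 x = f x" "\<forall>k. \<forall>x\<in>S. (D k has_real_derivative D (Suc k) x) (at x within S)"
    "\<forall>x\<in>S. E 0 x = g x" "\<forall>k. \<forall>x\<in>S. (E k has_real_derivative E (Suc k) x) (at x within S)"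
    using assms unfolding smooth_on_def by blast
  then show ?thesis unfolding smooth_on_def
    by (intro exI[of _ "\<lambda>k x. D k x + E k x"]) (auto intro!: derivative_intros)
qed

lemma smooth_on_scale:
  assumes "smooth_on S f" shows "smooth_on S (\<lambda>x. c * f x)"
proof -
  obtain D where "\<forall>x\<in>S. D 0 x = f x" "\<forall>k. \<forall>x\<in>S. (D k has_real_derivative D (Suc k) x) (at x within S)"
    using assms unfolding smooth_on_def by blast
  then show ?thesis unfolding smooth_on_def
    by (intro exI[of _ "\<lambda>k x. c * D k x"]) (auto intro!: DERIV_cmult)
qed

lemma smooth_on_times_shift:
  assumes "smooth_on S f" shows "smooth_on S (\<lambda>x. (x - a) * f x)"
proof -
  obtain D where D: "\<forall>x\<in>S. D 0 x = f x"
    "\<And>k x. x \<in> S \<Longrightarrow> (D k has_real_derivative D (Suc k) x) (at x within S)"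
    using assms unfolding smooth_on_def by blast
  \<comment> \<open>Leibniz formula for the \<open>k\<close>-th derivative of the product. For
    \<open>k = 0\<close> the truncated index \<open>k - 1\<close> is harmless, as its factor is
    0.\<close>
  have "((\<lambda>x. (x - a) * D k x + real k * D (k - 1) x) has_real_derivative
      (x - a) * D (Suc k) x + real (Suc k) * D k x) (at x within S)" if x: "x \<in> S" for k x
  proof (cases k)
    case 0
    then show ?thesis using D(2)[OF x, of 0] by (auto intro!: derivative_eq_intros)
  next
    case (Suc j)
    then show ?thesis using D(2)[OF x, of j] D(2)[OF x, of k]
      by (auto intro!: derivative_eq_intros simp: algebra_simps)
  qed
  then show ?thesis unfolding smooth_on_def using D(1)
    by (intro exI[of _ "\<lambda>k x. (x - a) * D k x + real k * D (k - 1) x"]) auto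
qed

lemma smooth_on_times_shift_power:
  "smooth_on S f \<Longrightarrow> smooth_on S (\<lambda>x. (x - a) ^ m * f x)"
proof (induction m)
  case (Suc m)
  then show ?case using smooth_on_times_shift[of S "\<lambda>x. (x - a) ^ m * f x" a] by (simp add: mult.assoc)
qed simp

text \<open>The quotient is \<open>\<integral> g'(\<alpha> + t (x - \<alpha>)) dt\<close> over \<open>[0, 1]\<close>.\<close>

lemma smooth_on_divide_shift:
  fixes \<alpha> :: real
  assumes g: "smooth_on {-1..1} g" and \<alpha>: "\<alpha> \<in> {-1..1}"
  obtains h where "smooth_on {-1..1} h" "\<And>x. x \<in> {-1..1} \<Longrightarrow> g x = g \<alpha> + (x - \<alpha>) * h x"
proof -
  obtain D where D0: "\<And>x. x \<in> {-1..1} \<Longrightarrow> D 0 x = g x"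
    and D: "\<And>k x. x \<in> {-1..1} \<Longrightarrow> (D k has_real_derivative D (Suc k) x) (at x within {-1..1})"
    using g unfolding smooth_on_def by blast
  \<comment> \<open>\<open>E k\<close> is the \<open>k\<close>-th derivative of the quotient: each
    differentiation under the integral sign contributes one factor \<open>t\<close> by the chain
    rule.\<close>
  define E where "E k x = integral {0..1} (\<lambda>t. t ^ k * D (Suc k) (\<alpha> + t * (x - \<alpha>)))" for k x
  have mem: "\<alpha> + t * (x - \<alpha>) \<in> {-1..1}" if "t \<in> {0..1}" "x \<in> {-1..1}" for t x
    using convexD_alt[of "{-1..1}" \<alpha> x t] that \<alpha> by (simp add: algebra_simps)
  have contD: "continuous_on {-1..1} (D k)" for k
    using D by (intro DERIV_continuous_on) auto
  have cont: "continuous_on ({-1..1} \<times> {0..1}) (\<lambda>(x, t). t ^ j * D k (\<alpha> + t * (x - \<alpha>)))" for j k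
    unfolding case_prod_unfold
    by (intro continuous_intros continuous_on_compose2[OF contD[of k]]) (use mem in force)
  have E: "(E k has_real_derivative E (Suc k) x) (at x within {-1..1})" if x: "x \<in> {-1..1}" for k x
  proof -
    have "((\<lambda>x. integral (cbox 0 1) (\<lambda>t. t ^ k * D (Suc k) (\<alpha> + t * (x - \<alpha>)))) has_field_derivative
        integral (cbox 0 1) (\<lambda>t. t ^ Suc k * D (Suc (Suc k)) (\<alpha> + t * (x - \<alpha>)))) (at x within {-1..1})"
    proof (rule leibniz_rule_field_derivative[where fx = "\<lambda>x t. t ^ Suc k * D (Suc (Suc k)) (\<alpha> + t * (x - \<alpha>))"])
      fix y t :: real assume y: "y \<in> {-1..1}" and t: "t \<in> cbox 0 1"
      have "((\<lambda>y. D (Suc k) (\<alpha> + t * (y - \<alpha>))) has_field_derivative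
          D (Suc (Suc k)) (\<alpha> + t * (y - \<alpha>)) * t) (at y within {-1..1})"
        using mem y t by (intro DERIV_chain_within[OF D]) (auto intro!: derivative_eq_intros)
      then show "((\<lambda>y. t ^ k * D (Suc k) (\<alpha> + t * (y - \<alpha>))) has_field_derivative
          t ^ Suc k * D (Suc (Suc k)) (\<alpha> + t * (y - \<alpha>))) (at y within {-1..1})"
        by (auto intro!: derivative_eq_intros)
    next
      fix y :: real assume y: "y \<in> {-1..1}"
      have "continuous_on {0..1} (\<lambda>t. t ^ k * D (Suc k) (\<alpha> + t * (y - \<alpha>)))"
        by (intro continuous_intros continuous_on_compose2[OF contD[of "Suc k"]]) (use mem y in force)+
      then show "(\<lambda>t. t ^ k * D (Suc k) (\<alpha> + t * (y - \<alpha>))) integrable_on cbox 0 1"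
        by (simp add: integrable_continuous_real)
    next
      show "continuous_on ({-1..1} \<times> cbox 0 1) (\<lambda>(x, t). t ^ Suc k * D (Suc (Suc k)) (\<alpha> + t * (x - \<alpha>)))"
        using cont[of "Suc k" "Suc (Suc k)"] by simp
    qed (use x in auto)
    then show ?thesis by (simp add: E_def[abs_def])
  qed
  have "g x = g \<alpha> + (x - \<alpha>) * E 0 x" if x: "x \<in> {-1..1}" for x
  proof -
    have "((\<lambda>t. (x - \<alpha>) * D 1 (\<alpha> + t * (x - \<alpha>))) has_integral g (\<alpha> + 1 * (x - \<alpha>)) - g (\<alpha> + 0 * (x - \<alpha>))) {0..1}"
    proof (rule fundamental_theorem_of_calculus)
      fix t :: real assume t: "t \<in> {0..1}"
      have "((\<lambda>t. D 0 (\<alpha> + t * (x - \<alpha>))) has_field_derivative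
          D 1 (\<alpha> + t * (x - \<alpha>)) * (x - \<alpha>)) (at t within {0..1})"
        using D[OF mem[OF t x], of 0] mem x
        by (intro DERIV_chain_within[where T = "{-1..1}"]) (auto intro!: derivative_eq_intros)
      then have "((\<lambda>t. D 0 (\<alpha> + t * (x - \<alpha>))) has_vector_derivative
          (x - \<alpha>) * D 1 (\<alpha> + t * (x - \<alpha>))) (at t within {0..1})"
        by (simp add: has_real_derivative_iff_has_vector_derivative mult.commute)
      then show "((\<lambda>t. g (\<alpha> + t * (x - \<alpha>))) has_vector_derivative
          (x - \<alpha>) * D 1 (\<alpha> + t * (x - \<alpha>))) (at t within {0..1})"
        by (rule has_vector_derivative_transform[rotated 2]) (use t mem x D0 in auto)
    qed simp
    then have "g x - g \<alpha> = integral {0..1} (\<lambda>t. (x - \<alpha>) * D 1 (\<alpha> + t * (x - \<alpha>)))"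
      by (simp add: has_integral_iff)
    then show ?thesis by (simp add: E_def)
  qed
  moreover have "smooth_on {-1..1} (E 0)" unfolding smooth_on_def using E by blast
  ultimately show ?thesis using that by blast
qed

text \<open>Repeated division by \<open>x - \<alpha>\<close> keeps the remainder factor
  \<open>h\<close> smooth up to the endpoints, whereas a mean-value form of the remainder would not
  give its derivatives.\<close>

lemma smooth_on_taylor:
  fixes \<alpha> :: real
  assumes g: "smooth_on {-1..1} g" and \<alpha>: "\<alpha> \<in> {-1..1}"
  shows "\<exists>p h. p \<in> span_on monomials m \<and> smooth_on {-1..1} h \<and> (\<forall>x\<in>{-1..1}. g x = p x + (x - \<alpha>) ^ m * h x)"
proof (induction m)
  case 0
  then show ?case using g span_on_zero by fastforce
next
  case (Suc m)
  then obtain p h where p: "p \<in> span_on monomials m" and h: "smooth_on {-1..1} h"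
    and eq: "\<forall>x\<in>{-1..1}. g x = p x + (x - \<alpha>) ^ m * h x" by blast
  obtain k where k: "smooth_on {-1..1} k" "\<And>x. x \<in> {-1..1} \<Longrightarrow> h x = h \<alpha> + (x - \<alpha>) * k x"
    using smooth_on_divide_shift[OF h \<alpha>] by blast
  have pw: "(\<lambda>x. (x - \<alpha>) ^ i) \<in> span_on monomials (Suc i)" for i
  proof (induction i)
    case 0
    then show ?case using span_on_base[of 0 "Suc 0" monomials] by simp
  next
    case (Suc i)
    have "(\<lambda>x. x * (x - \<alpha>) ^ i + (- \<alpha>) * (x - \<alpha>) ^ i) \<in> span_on monomials (Suc (Suc i))"
      using Suc by (intro span_on_add span_on_scale span_on_monomials_times) (auto intro: span_on_mono)
    then show ?case by (simp add: algebra_simps)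
  qed
  have "(\<lambda>x. p x + h \<alpha> * (x - \<alpha>) ^ m) \<in> span_on monomials (Suc m)"
    using p pw by (intro span_on_add span_on_scale) (auto intro: span_on_mono)
  moreover have "g x = (p x + h \<alpha> * (x - \<alpha>) ^ m) + (x - \<alpha>) ^ Suc m * k x" if "x \<in> {-1..1}" for x
    unfolding eq[rule_format, OF that] k(2)[OF that] by (simp add: algebra_simps)
  ultimately show ?case using k(1) by blast
qed

section \<open>The logarithm near its singularity\<close>

text \<open>The real \<open>ln\<close> is extended to negative arguments as an even function, so an
  absolute value inside it may be dropped.\<close>

lemma ln_abs: "ln \<bar>x\<bar> = ln x" for x :: real
  by (simp add: abs_if ln_minus)

lemma DERIV_ln_abs: "x \<noteq> 0 \<Longrightarrow> ((\<lambda>x. ln \<bar>x\<bar>) has_real_derivative 1 / x) (at x)" for x :: real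
proof -
  assume x: "x \<noteq> 0"
  show ?thesis
  proof (cases "x > 0")
    case True
    then show ?thesis unfolding ln_abs by (rule DERIV_ln_divide)
  next
    case False
    have "((\<lambda>x. ln (- x)) has_real_derivative 1 / x) (at x)"
      using False x by (auto intro!: derivative_eq_intros)
    then show ?thesis unfolding ln_abs by (simp add: ln_minus)
  qed
qed

lemma DERIV_ln_abs_shift:
  "x \<noteq> \<alpha> \<Longrightarrow> ((\<lambda>x. ln \<bar>x - \<alpha>\<bar>) has_real_derivative 1 / (x - \<alpha>)) (at x within S)" for x \<alpha> :: real
proof -
  assume "x \<noteq> \<alpha>"
  then have "((\<lambda>x. ln \<bar>x - \<alpha>\<bar>) has_real_derivative 1 / (x - \<alpha>) * 1) (at x within S)"
    by (intro DERIV_chain2[OF DERIV_ln_abs]) (auto intro!: derivative_eq_intros)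
  then show ?thesis by simp
qed

lemma x_ln_abs_tendsto_0: "((\<lambda>y. y * ln \<bar>y\<bar>) \<longlongrightarrow> 0) (at (0::real))"
  by real_asymp

lemma x_ln_abs_shift_tendsto_0:
  "((\<lambda>y. (y - \<alpha>) * ln \<bar>y - \<alpha>\<bar>) \<longlongrightarrow> 0) (at \<alpha> within S)" for \<alpha> :: real
proof (rule filterlim_compose[OF x_ln_abs_tendsto_0])
  show "LIM y at \<alpha> within S. y - \<alpha> :> at 0"
    by (auto simp: filterlim_at eventually_at_filter intro!: tendsto_eq_intros)
qed

text \<open>With \<open>s = \<epsilon> / \<bar>y\<bar>\<close> the two logarithms differ by
  \<open>ln (1 + s\<^sup>2) / 2 \<le> ln (1 + s) \<le> s\<close>, and
  \<open>\<bar>y\<bar> * s = \<epsilon>\<close>.\<close>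

lemma ln_smoothing_error:
  fixes y \<epsilon> :: real
  assumes "\<epsilon> > 0"
  shows "\<bar>y * (ln \<bar>y\<bar> - ln (y\<^sup>2 + \<epsilon>\<^sup>2) / 2)\<bar> \<le> \<epsilon>"
proof (cases "y = 0")
  case False
  define s where "s = \<epsilon> / \<bar>y\<bar>"
  have s: "s > 0" using False assms by (simp add: s_def)
  have "y\<^sup>2 + \<epsilon>\<^sup>2 = \<bar>y\<bar>\<^sup>2 * (1 + s\<^sup>2)"
    using False by (simp add: s_def field_simps)
  then have eq: "ln (y\<^sup>2 + \<epsilon>\<^sup>2) = 2 * ln \<bar>y\<bar> + ln (1 + s\<^sup>2)"
    using False s by (simp add: ln_mult_pos ln_realpow add_pos_pos ln_abs)
  have "ln (1 + s\<^sup>2) \<le> ln ((1 + s)\<^sup>2)"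
    using s by (subst ln_le_cancel_iff) (auto simp: power2_sum add_pos_pos)
  also have "\<dots> = 2 * ln (1 + s)" using s by (simp add: ln_realpow)
  also have "\<dots> \<le> 2 * s" using ln_add_one_self_le_self[of s] s by simp
  finally have "ln (1 + s\<^sup>2) / 2 \<le> s" by simp
  moreover have "ln (1 + s\<^sup>2) \<ge> 0" by simp
  ultimately have "\<bar>y\<bar> * (ln (1 + s\<^sup>2) / 2) \<le> \<bar>y\<bar> * s" by (intro mult_left_mono) auto
  moreover have "\<bar>y\<bar> * s = \<epsilon>" using False by (simp add: s_def)
  moreover have "ln \<bar>y\<bar> - ln (y\<^sup>2 + \<epsilon>\<^sup>2) / 2 = - (ln (1 + s\<^sup>2) / 2)"
    unfolding eq by (simp add: field_simps)
  ultimately show ?thesis using \<open>ln (1 + s\<^sup>2) \<ge> 0\<close> by (simp add: abs_mult)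
qed (use assms in auto)

section \<open>Uniform polynomial approximation of functions with a logarithmic factor\<close>

text \<open>The smoothed function \<open>F\<close> has \<open>F2 = O(n)\<close> as second derivative
  when \<open>\<epsilon> = 1 / n\<close>. Approximating \<open>F2\<close> by 0 and integrating twice
  through Jackson's inequality gains two factors \<open>1 / n\<close>, so \<open>F\<close> is
  approximated to \<open>O(1 / n)\<close>, the same order as the smoothing error.\<close>

lemma approx_log_base:
  fixes g h :: "real \<Rightarrow> real"
  assumes g: "smooth_on {-1..1} g" and h: "smooth_on {-1..1} h" and \<alpha>: "\<alpha> \<in> {-1..1}"
  shows "\<exists>C\<ge>0. \<forall>n\<ge>2. \<exists>p\<in>span_on monomials n. \<forall>x\<in>{-1..1}.
    \<bar>g x + (x - \<alpha>) * h x * ln \<bar>x - \<alpha>\<bar> - p x\<bar> \<le> C / real n"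
proof -
  define r where "r x = (x - \<alpha>) * h x" for x
  have r: "smooth_on {-1..1} r" unfolding r_def[abs_def] by (rule smooth_on_times_shift[OF h])
  obtain g' where g': "smooth_on {-1..1} g'"
    "\<And>x. x \<in> {-1..1} \<Longrightarrow> (g has_real_derivative g' x) (at x within {-1..1})"
    by (rule smooth_onE[OF g]) blast
  obtain g'' where g'': "smooth_on {-1..1} g''"
    "\<And>x. x \<in> {-1..1} \<Longrightarrow> (g' has_real_derivative g'' x) (at x within {-1..1})"
    by (rule smooth_onE[OF g'(1)]) blast
  obtain r' where r': "smooth_on {-1..1} r'"
    "\<And>x. x \<in> {-1..1} \<Longrightarrow> (r has_real_derivative r' x) (at x within {-1..1})"
    by (rule smooth_onE[OF r]) blast
  obtain r'' where r'': "smooth_on {-1..1} r''"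
    "\<And>x. x \<in> {-1..1} \<Longrightarrow> (r' has_real_derivative r'' x) (at x within {-1..1})"
    by (rule smooth_onE[OF r'(1)]) blast
  obtain H where H: "H \<ge> 0" "\<And>x. x \<in> {-1..1} \<Longrightarrow> \<bar>h x\<bar> \<le> H" by (rule smooth_on_bounded[OF h]) blast
  obtain R1 where R1: "R1 \<ge> 0" "\<And>x. x \<in> {-1..1} \<Longrightarrow> \<bar>r' x\<bar> \<le> R1" by (rule smooth_on_bounded[OF r'(1)]) blast
  obtain R2 where R2: "R2 \<ge> 0" "\<And>x. x \<in> {-1..1} \<Longrightarrow> \<bar>r'' x\<bar> \<le> R2" by (rule smooth_on_bounded[OF r''(1)]) blast
  obtain G2 where G2: "G2 \<ge> 0" "\<And>x. x \<in> {-1..1} \<Longrightarrow> \<bar>g'' x\<bar> \<le> G2" by (rule smooth_on_bounded[OF g''(1)]) blast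
  \<comment> \<open>\<open>E / \<epsilon>\<close> will bound the second derivative of
    \<open>F\<close>: the constants 4 and 2 come from
    \<open>\<bar>l0 x\<bar> \<le> 4 / \<epsilon>\<close> and from the doubled mixed term of the
    product rule.\<close>
  define E where "E = G2 + 4 * R2 + 2 * R1 + H"
  have E: "E \<ge> 0" using H R1 R2 G2 by (simp add: E_def)
  have "\<exists>p\<in>span_on monomials n. \<forall>x\<in>{-1..1}.
    \<bar>g x + (x - \<alpha>) * h x * ln \<bar>x - \<alpha>\<bar> - p x\<bar> \<le> (E * pi * pi + H) / real n" if n: "n \<ge> 2" for n
  proof -
    define \<epsilon> where "\<epsilon> = 1 / real n"
    have \<epsilon>: "\<epsilon> > 0" "\<epsilon> \<le> 1" using n by (auto simp: \<epsilon>_def)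
    define W where "W x = (x - \<alpha>)\<^sup>2 + \<epsilon>\<^sup>2" for x
    have W: "W x > 0" for x using \<epsilon> by (simp add: W_def add_nonneg_pos)
    \<comment> \<open>The smoothed logarithm together with its first two derivatives.\<close>
    define l0 where "l0 x = ln (W x) / 2" for x
    define l1 where "l1 x = (x - \<alpha>) / W x" for x
    define l2 where "l2 x = (\<epsilon>\<^sup>2 - (x - \<alpha>)\<^sup>2) / (W x)\<^sup>2" for x
    have dW: "(W has_real_derivative 2 * (x - \<alpha>)) (at x within S)" for x S
      unfolding W_def by (auto intro!: derivative_eq_intros)
    have d0: "(l0 has_real_derivative l1 x) (at x within S)" for x S
      unfolding l0_def[abs_def] l1_def using W[of x]
      by (auto intro!: derivative_eq_intros dW simp: divide_simps)
    have d1: "(l1 has_real_derivative l2 x) (at x within S)" for x S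
    proof -
      have "(l1 has_real_derivative (1 * W x - (x - \<alpha>) * (2 * (x - \<alpha>))) / (W x * W x)) (at x within S)"
        unfolding l1_def[abs_def] using W[of x]
        by (intro DERIV_divide dW) (auto intro!: derivative_eq_intros)
      moreover have "1 * W x - (x - \<alpha>) * (2 * (x - \<alpha>)) = \<epsilon>\<^sup>2 - (x - \<alpha>)\<^sup>2"
        by (simp add: W_def power2_eq_square)
      ultimately show ?thesis by (simp only: l2_def power2_eq_square[of "W x"])
    qed
    have y2: "\<bar>x - \<alpha>\<bar> \<le> 2" if "x \<in> {-1..1}" for x using that \<alpha> by auto
    \<comment> \<open>A crude bound is enough: from above \<open>W x \<le> 5\<close>, from below
      \<open>ln \<epsilon> \<ge> - 1 / \<epsilon>\<close>.\<close>
    have b0: "\<bar>l0 x\<bar> \<le> 4 / \<epsilon>" if x: "x \<in> {-1..1}" for x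
    proof -
      have "(x - \<alpha>)\<^sup>2 \<le> 2\<^sup>2" using y2[OF x] abs_le_square_iff[of "x - \<alpha>" 2] by simp
      moreover have "\<epsilon>\<^sup>2 \<le> 1" using \<epsilon> by (simp add: power_le_one)
      ultimately have "W x \<le> 5" by (simp add: W_def)
      then have "l0 x \<le> 3" using ln_less_self[OF W[of x]] by (simp add: l0_def)
      also have "3 \<le> 4 / \<epsilon>" using \<epsilon> by (simp add: field_simps)
      finally have up: "l0 x \<le> 4 / \<epsilon>" .
      have "ln (\<epsilon>\<^sup>2) \<le> ln (W x)" using \<epsilon> W[of x] by (subst ln_le_cancel_iff) (auto simp: W_def)
      then have "ln \<epsilon> \<le> l0 x" using \<epsilon> by (simp add: l0_def ln_realpow)
      moreover have "- ln \<epsilon> \<le> 1 / \<epsilon>" using ln_less_self[of "1 / \<epsilon>"] \<epsilon> by (simp add: ln_div)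
      moreover have "1 / \<epsilon> \<le> 4 / \<epsilon>" using \<epsilon> by (simp add: divide_right_mono)
      ultimately show ?thesis using up by (simp add: abs_le_iff)
    qed
    have b1: "\<bar>l1 x\<bar> \<le> 1 / \<epsilon>" for x
    proof -
      have "2 * \<bar>x - \<alpha>\<bar> * \<epsilon> \<le> W x"
        using sum_squares_bound[of "\<bar>x - \<alpha>\<bar>" \<epsilon>] by (simp add: W_def)
      moreover have "\<bar>x - \<alpha>\<bar> * \<epsilon> \<ge> 0" using \<epsilon> by simp
      ultimately have "\<bar>x - \<alpha>\<bar> * \<epsilon> \<le> W x" by linarith
      then show ?thesis using W[of x] \<epsilon> by (simp add: l1_def abs_divide field_simps)
    qed
    \<comment> \<open>Alone, \<open>l2\<close> can reach \<open>1 / \<epsilon>\<^sup>2\<close>,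
      namely at \<alpha>. The factor \<open>x - \<alpha>\<close> of \<open>r\<close> saves one
      order, because
      \<open>\<bar>(x - \<alpha>) * l2 x\<bar> \<le> \<bar>l1 x\<bar>\<close>.\<close>
    have b2: "\<bar>r x * l2 x\<bar> \<le> H / \<epsilon>" if x: "x \<in> {-1..1}" for x
    proof -
      have "\<bar>\<epsilon>\<^sup>2 - (x - \<alpha>)\<^sup>2\<bar> \<le> W x" by (simp add: W_def abs_le_iff)
      then have "\<bar>l2 x\<bar> \<le> W x / (W x)\<^sup>2"
        unfolding l2_def abs_divide by (simp add: divide_right_mono)
      then have "\<bar>(x - \<alpha>) * l2 x\<bar> \<le> \<bar>x - \<alpha>\<bar> * (W x / (W x)\<^sup>2)"
        unfolding abs_mult by (rule mult_left_mono) simp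
      also have "\<dots> = \<bar>l1 x\<bar>" using W[of x] by (simp add: l1_def abs_divide power2_eq_square)
      also have "\<dots> \<le> 1 / \<epsilon>" by (rule b1)
      finally have "\<bar>h x\<bar> * \<bar>(x - \<alpha>) * l2 x\<bar> \<le> H * (1 / \<epsilon>)"
        using H(2)[OF x] H(1) by (intro mult_mono) auto
      moreover have "r x * l2 x = h x * ((x - \<alpha>) * l2 x)" by (simp add: r_def)
      ultimately show ?thesis by (simp only: abs_mult mult_1_right times_divide_eq_right)
    qed
    define F where "F x = g x + r x * l0 x" for x
    define F1 where "F1 x = g' x + (r' x * l0 x + r x * l1 x)" for x
    define F2 where "F2 x = g'' x + (r'' x * l0 x + 2 * (r' x * l1 x) + r x * l2 x)" for x
    have dF: "(F has_real_derivative F1 x) (at x within {-1..1})" if x: "x \<in> {-1..1}" for x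
      unfolding F_def[abs_def] F1_def
      by (rule derivative_eq_intros g'(2)[OF x] r'(2)[OF x] d0 | simp)+
    have dF1: "(F1 has_real_derivative F2 x) (at x within {-1..1})" if x: "x \<in> {-1..1}" for x
      unfolding F1_def[abs_def] F2_def
      by (rule derivative_eq_intros g''(2)[OF x] r'(2)[OF x] r''(2)[OF x] d0 d1 | simp)+
    have bF2: "\<bar>F2 x - 0\<bar> \<le> E / \<epsilon>" if x: "x \<in> {-1..1}" for x
    proof -
      have "\<bar>g'' x\<bar> \<le> G2 / \<epsilon>"
        using mult_mono[OF \<epsilon>(2) G2(2)[OF x]] \<epsilon>(1) by (simp add: field_simps)
      moreover have "\<bar>r'' x * l0 x\<bar> \<le> R2 * (4 / \<epsilon>)"
        unfolding abs_mult using R2(2)[OF x] b0[OF x] R2(1) by (intro mult_mono) auto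
      moreover have "\<bar>r' x * l1 x\<bar> \<le> R1 * (1 / \<epsilon>)"
        unfolding abs_mult using R1(2)[OF x] b1[of x] R1(1) by (intro mult_mono) auto
      moreover have "\<bar>F2 x\<bar> \<le> \<bar>g'' x\<bar> + \<bar>r'' x * l0 x\<bar> + 2 * \<bar>r' x * l1 x\<bar> + \<bar>r x * l2 x\<bar>"
        unfolding F2_def by linarith
      moreover have "E / \<epsilon> = G2 / \<epsilon> + R2 * (4 / \<epsilon>) + 2 * (R1 * (1 / \<epsilon>)) + H / \<epsilon>"
        by (simp add: E_def add_divide_distrib)
      ultimately show ?thesis using b2[OF x] by linarith
    qed
    \<comment> \<open>The zero polynomial is taken in the span of size \<open>n - 2\<close>; each of
      the two integrations enlarges the span by one. The first yields the error
      \<open>E * n * pi / n = E * pi\<close> for \<open>F1\<close>.\<close>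
    obtain k where k: "n = Suc (Suc k)" using n by (metis add_2_eq_Suc le_Suc_ex)
    obtain q where q: "q \<in> span_on monomials (Suc k)"
      "\<forall>x\<in>{-1..1}. \<bar>F1 x - q x\<bar> \<le> E / \<epsilon> * pi / real (Suc (Suc k))"
      using jackson_integrate[OF span_on_zero bF2 dF1] by blast
    have "E / \<epsilon> * pi / real (Suc (Suc k)) = E * pi"
      by (simp add: \<epsilon>_def k del: of_nat_Suc)
    then have "\<And>x. x \<in> {-1..1} \<Longrightarrow> \<bar>F1 x - q x\<bar> \<le> E * pi" using q(2) by simp
    from jackson_integrate[OF q(1) this dF]
    obtain p where p: "p \<in> span_on monomials n"
      "\<forall>x\<in>{-1..1}. \<bar>F x - p x\<bar> \<le> E * pi * pi / real (Suc n)"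
      unfolding k by blast
    have "\<bar>g x + (x - \<alpha>) * h x * ln \<bar>x - \<alpha>\<bar> - p x\<bar> \<le> (E * pi * pi + H) / real n"
      if x: "x \<in> {-1..1}" for x
    proof -
      have "g x + (x - \<alpha>) * h x * ln \<bar>x - \<alpha>\<bar> - F x = h x * ((x - \<alpha>) * (ln \<bar>x - \<alpha>\<bar> - l0 x))"
        by (simp add: F_def r_def algebra_simps)
      moreover have "\<bar>h x * ((x - \<alpha>) * (ln \<bar>x - \<alpha>\<bar> - l0 x))\<bar> \<le> H * \<epsilon>"
        unfolding abs_mult[of "h x"] l0_def W_def
        using H(2)[OF x] H(1) ln_smoothing_error[OF \<epsilon>(1)] by (intro mult_mono) auto
      ultimately have "\<bar>g x + (x - \<alpha>) * h x * ln \<bar>x - \<alpha>\<bar> - F x\<bar> \<le> H / real n"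
        by (simp add: \<epsilon>_def)
      moreover have "\<bar>F x - p x\<bar> \<le> E * pi * pi / real n"
      proof (rule order_trans)
        show "\<bar>F x - p x\<bar> \<le> E * pi * pi / real (Suc n)" using p(2) x by blast
        show "E * pi * pi / real (Suc n) \<le> E * pi * pi / real n"
          using E n by (intro divide_left_mono) auto
      qed
      ultimately show ?thesis by (simp add: add_divide_distrib)
    qed
    then show ?thesis using p(1) by blast
  qed
  moreover have "E * pi * pi + H \<ge> 0" using E H by simp
  ultimately show ?thesis by blast
qed

text \<open>Differentiation lowers the power of \<open>x - \<alpha>\<close> by one and keeps the
  shape: the derivative of \<open>ln\<close> feeds the smooth part \<open>G\<close>, the product
  rule feeds \<open>H\<close>. Integrating an approximation of the derivative then costs one degree
  and gains a factor \<open>1 / n\<close>.\<close>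

lemma approx_log:
  fixes g h :: "real \<Rightarrow> real"
  assumes "smooth_on {-1..1} g" "smooth_on {-1..1} h" and \<alpha>: "\<alpha> \<in> {-1..1}"
  shows "\<exists>C\<ge>0. \<forall>n\<ge>m + 2. \<exists>p\<in>span_on monomials n. \<forall>x\<in>{-1..1}.
    \<bar>g x + (x - \<alpha>) ^ Suc m * h x * ln \<bar>x - \<alpha>\<bar> - p x\<bar> \<le> C / real n ^ Suc m"
  using assms(1,2)
proof (induction m arbitrary: g h)
  case 0
  then show ?case using approx_log_base[OF 0 \<alpha>] by (simp only: add_0 power_Suc0_right One_nat_def)
next
  case (Suc m)
  obtain g' where g': "smooth_on {-1..1} g'"
    "\<And>x. x \<in> {-1..1} \<Longrightarrow> (g has_real_derivative g' x) (at x within {-1..1})"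
    by (rule smooth_onE[OF Suc.prems(1)]) blast
  obtain h' where h': "smooth_on {-1..1} h'"
    "\<And>x. x \<in> {-1..1} \<Longrightarrow> (h has_real_derivative h' x) (at x within {-1..1})"
    by (rule smooth_onE[OF Suc.prems(2)]) blast
  define G where "G x = g' x + (x - \<alpha>) ^ Suc m * h x" for x
  define H where "H x = real (m + 2) * h x + (x - \<alpha>) * h' x" for x
  define f where "f x = g x + (x - \<alpha>) ^ Suc (Suc m) * h x * ln \<bar>x - \<alpha>\<bar>" for x
  define f' where "f' x = G x + (x - \<alpha>) ^ Suc m * H x * ln \<bar>x - \<alpha>\<bar>" for x
  have G: "smooth_on {-1..1} G" unfolding G_def[abs_def]
    by (intro smooth_on_add g' smooth_on_times_shift_power Suc.prems)
  have H: "smooth_on {-1..1} H" unfolding H_def[abs_def]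
    by (intro smooth_on_add smooth_on_scale smooth_on_times_shift h' Suc.prems)
  have df: "(f has_real_derivative f' x) (at x within {-1..1})" if x: "x \<in> {-1..1}" for x
  proof (cases "x = \<alpha>")
    case False
    have pow: "((\<lambda>x. (x - \<alpha>) ^ Suc (Suc m)) has_real_derivative real (m + 2) * (x - \<alpha>) ^ Suc m) (at x within {-1..1})"
    proof -
      have "((\<lambda>x. x - \<alpha>) has_real_derivative 1) (at x within {-1..1})" by (auto intro!: derivative_eq_intros)
      from DERIV_power[OF this, of "Suc (Suc m)"] show ?thesis by simp
    qed
    have "(f has_real_derivative g' x + ((real (m + 2) * (x - \<alpha>) ^ Suc m * h x
        + h' x * (x - \<alpha>) ^ Suc (Suc m)) * ln \<bar>x - \<alpha>\<bar>
        + 1 / (x - \<alpha>) * ((x - \<alpha>) ^ Suc (Suc m) * h x))) (at x within {-1..1})"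
      unfolding f_def[abs_def]
      by (intro DERIV_add DERIV_mult g'(2)[OF x] h'(2)[OF x] pow DERIV_ln_abs_shift False)
    moreover have "1 / (x - \<alpha>) * ((x - \<alpha>) ^ Suc (Suc m) * h x) = (x - \<alpha>) ^ Suc m * h x"
      using False by simp
    ultimately show ?thesis
      by (simp only: f'_def G_def H_def) (simp add: algebra_simps)
  next
    case True
    \<comment> \<open>At \<alpha> the logarithmic term vanishes whatever the default value of
      \<open>ln 0\<close>. Its difference quotient there is
      \<open>(y - \<alpha>) ln \<bar>y - \<alpha>\<bar>\<close> times a factor with a finite limit,
      so its derivative is 0.\<close>
    have "continuous_on {-1..1} h" using Suc.prems(2) by (rule smooth_on_continuous)
    then have "(h \<longlongrightarrow> h \<alpha>) (at \<alpha> within {-1..1})" using \<alpha> by (simp add: continuous_on)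
    moreover have "((\<lambda>y. (y - \<alpha>) ^ m) \<longlongrightarrow> (\<alpha> - \<alpha>) ^ m) (at \<alpha> within {-1..1})"
      by (intro tendsto_intros)
    ultimately have "((\<lambda>y. ((y - \<alpha>) * ln \<bar>y - \<alpha>\<bar>) * ((y - \<alpha>) ^ m * h y)) \<longlongrightarrow> 0 * ((\<alpha> - \<alpha>) ^ m * h \<alpha>))
        (at \<alpha> within {-1..1})"
      by (intro tendsto_mult x_ln_abs_shift_tendsto_0)
    then have "((\<lambda>x. (x - \<alpha>) ^ Suc (Suc m) * h x * ln \<bar>x - \<alpha>\<bar>) has_real_derivative 0) (at \<alpha> within {-1..1})"
      unfolding has_field_derivative_iff
      by (simp only: mult_zero_left, elim Lim_transform_eventually) (auto simp: eventually_at_filter)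
    from DERIV_add[OF g'(2)[OF \<alpha>] this]
    have "(f has_real_derivative g' \<alpha> + 0) (at \<alpha> within {-1..1})" unfolding f_def .
    moreover have "f' \<alpha> = g' \<alpha> + 0" by (simp add: f'_def G_def)
    ultimately show ?thesis unfolding True by simp
  qed
  obtain C where C: "C \<ge> 0" and approx: "\<And>n. n \<ge> m + 2 \<Longrightarrow> \<exists>p\<in>span_on monomials n. \<forall>x\<in>{-1..1}.
      \<bar>f' x - p x\<bar> \<le> C / real n ^ Suc m"
    using Suc.IH[OF G H] unfolding f'_def by blast
  have "\<exists>p\<in>span_on monomials n. \<forall>x\<in>{-1..1}. \<bar>f x - p x\<bar> \<le> (C * 2 ^ Suc m * pi) / real n ^ Suc (Suc m)"
    if n: "n \<ge> Suc m + 2" for n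
  proof -
    obtain k where k: "n = Suc k" "k \<ge> m + 2" using n by (cases n) auto
    obtain q where q: "q \<in> span_on monomials k"
      "\<And>x. x \<in> {-1..1} \<Longrightarrow> \<bar>f' x - q x\<bar> \<le> C / real k ^ Suc m"
      using approx[OF k(2)] by blast
    obtain p where p: "p \<in> span_on monomials n"
      "\<And>x. x \<in> {-1..1} \<Longrightarrow> \<bar>f x - p x\<bar> \<le> C / real k ^ Suc m * pi / real (Suc n)"
      using jackson_integrate[OF q df] unfolding k(1) by blast
    \<comment> \<open>The induction hypothesis speaks of \<open>k = n - 1\<close>; since
      \<open>n \<le> 2 k\<close>, returning to \<open>n\<close> costs the factor
      \<open>2 ^ Suc m\<close>.\<close>
    have "real n ^ Suc m \<le> (2 * real k) ^ Suc m" using k by (intro power_mono) auto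
    then have "C * real n ^ Suc m \<le> C * (2 ^ Suc m * real k ^ Suc m)"
      using C unfolding power_mult_distrib by (rule mult_left_mono)
    then have "C / real k ^ Suc m \<le> C * 2 ^ Suc m / real n ^ Suc m"
      using k by (simp add: divide_le_eq le_divide_eq mult.assoc del: power_Suc)
    then have "C / real k ^ Suc m * pi / real (Suc n) \<le> C * 2 ^ Suc m / real n ^ Suc m * pi / real n"
      using n C by (intro frac_le[OF _ mult_right_mono]) auto
    also have "\<dots> = (C * 2 ^ Suc m * pi) / real n ^ Suc (Suc m)"
      by (simp add: mult_ac)
    finally show ?thesis using order_trans[OF p(2)] by (intro bexI[OF _ p(1)] ballI)
  qed
  moreover have "C * 2 ^ Suc m * pi \<ge> 0" using C by simp
  ultimately show ?case unfolding f_def by blast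
qed

section \<open>Integration over the punctured interval\<close>

text \<open>A single point is a null set, so neither the default \<open>ln 0\<close> nor the
  arbitrary value of an extensional function at \<alpha> affects an integral.\<close>

lemma set_integrable_punctured: "set_integrable lborel {-1..1} f \<longleftrightarrow> set_integrable lborel (punctured \<alpha>) f"
  for f :: "real \<Rightarrow> real"
  by (rule set_integrable_discrete_difference[where X = "{\<alpha>}"]) (auto simp: punctured_def)

lemma set_integral_punctured:
  "(LBINT x:{-1..1}. f x) = (LBINT x:punctured \<alpha>. f x)" for f :: "real \<Rightarrow> real"
  by (rule set_integral_discrete_difference[where X = "{\<alpha>}"]) (auto simp: punctured_def)

lemma sets_punctured [measurable]: "punctured \<alpha> \<in> sets borel"
  by (simp add: punctured_def)

lemma integrable_cong_punctured:
  fixes u v :: "real \<Rightarrow> real"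
  assumes "\<And>x. x \<in> punctured \<alpha> \<Longrightarrow> u x = v x"
  shows "set_integrable lborel {-1..1} u \<longleftrightarrow> set_integrable lborel {-1..1} v"
  unfolding set_integrable_punctured[of _ \<alpha>] using assms by (intro set_integrable_cong) auto

lemma integral_cong_punctured:
  fixes u v :: "real \<Rightarrow> real"
  assumes "\<And>x. x \<in> punctured \<alpha> \<Longrightarrow> u x = v x"
  shows "(LBINT x:{-1..1}. u x) = (LBINT x:{-1..1}. v x)"
  unfolding set_integral_punctured[of _ \<alpha>] using assms by (intro set_lebesgue_integral_cong) auto

lemma norm1_cong: "(\<And>x. x \<in> punctured \<alpha> \<Longrightarrow> u x = v x) \<Longrightarrow> norm1 u = norm1 v"
  unfolding norm1_def by (rule integral_cong_punctured[of \<alpha>]) auto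

lemma norm1_nonneg: "norm1 u \<ge> 0"
  unfolding norm1_def set_lebesgue_integral_def by (rule Bochner_Integration.integral_nonneg) auto

lemma integral_le_punctured:
  fixes u v :: "real \<Rightarrow> real"
  assumes "set_integrable lborel {-1..1} u" "set_integrable lborel {-1..1} v"
    and "\<And>x. x \<in> punctured \<alpha> \<Longrightarrow> u x \<le> v x"
  shows "(LBINT x:{-1..1}. u x) \<le> (LBINT x:{-1..1}. v x)"
  using assms unfolding set_integrable_punctured[of _ \<alpha>] set_integral_punctured[of _ \<alpha>]
  by (rule set_integral_mono)

lemma norm1_add_le:
  assumes "set_integrable lborel {-1..1} u" "set_integrable lborel {-1..1} v"
  shows "norm1 (\<lambda>x. u x + v x) \<le> norm1 u + norm1 v"
proof -
  have "norm1 (\<lambda>x. u x + v x) \<le> (LBINT x:{-1..1}. \<bar>u x\<bar> + \<bar>v x\<bar>)"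
    unfolding norm1_def using assms by (intro set_integral_mono set_integrable_abs set_integral_add) auto
  also have "\<dots> = norm1 u + norm1 v"
    unfolding norm1_def using assms by (intro set_integral_add set_integrable_abs)
  finally show ?thesis .
qed

lemma norm1_mult: "norm1 (\<lambda>x. c * u x) = \<bar>c\<bar> * norm1 u"
  unfolding norm1_def abs_mult by (rule set_integral_mult_right)

lemma set_integrable_sum_real:
  fixes u :: "'i \<Rightarrow> real \<Rightarrow> real"
  assumes "\<And>i. i \<in> A \<Longrightarrow> set_integrable lborel S (u i)"
  shows "set_integrable lborel S (\<lambda>x. \<Sum>i\<in>A. u i x)"
    and "(LBINT x:S. \<Sum>i\<in>A. u i x) = (\<Sum>i\<in>A. LBINT x:S. u i x)"
  using assms unfolding set_integrable_def set_lebesgue_integral_def scaleR_sum_right by simp_all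

lemma norm1_lincomb_le:
  assumes "finite A" "\<And>i. i \<in> A \<Longrightarrow> set_integrable lborel {-1..1} (u i)"
  shows "norm1 (\<lambda>x. \<Sum>i\<in>A. c i * u i x) \<le> (\<Sum>i\<in>A. \<bar>c i\<bar> * norm1 (u i))"
  using assms
proof (induction A rule: finite_induct)
  case empty
  then show ?case by (simp add: norm1_def)
next
  case (insert a A)
  then have "norm1 (\<lambda>x. c a * u a x + (\<Sum>i\<in>A. c i * u i x))
      \<le> norm1 (\<lambda>x. c a * u a x) + norm1 (\<lambda>x. \<Sum>i\<in>A. c i * u i x)"
    by (intro norm1_add_le set_integrable_sum_real set_integrable_mult_right) auto
  then show ?case using insert by (simp add: norm1_mult)
qed

text \<open>The antiderivative \<open>(x - \<alpha>) ln \<bar>x - \<alpha>\<bar> - x\<close> is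
  continuous across \<alpha>, so the fundamental theorem holds with one exceptional point and gives
  gauge integrability.\<close>

lemma set_integrable_ln_shift: "set_integrable lborel {-1..1} (\<lambda>x. ln \<bar>x - \<alpha>\<bar>)" for \<alpha> :: real
proof -
  have "((\<lambda>x. ln \<bar>x - \<alpha>\<bar>) has_integral
      ((1 - \<alpha>) * ln \<bar>1 - \<alpha>\<bar> - 1 - ((-1 - \<alpha>) * ln \<bar>-1 - \<alpha>\<bar> - (-1)))) {-1..1}"
  proof (rule fundamental_theorem_of_calculus_interior_strong[where S = "{\<alpha>}"
        and f = "\<lambda>x. (x - \<alpha>) * ln \<bar>x - \<alpha>\<bar> - x"])
    fix x assume "x \<in> {-1<..<1} - {\<alpha>}"
    then have x: "x \<noteq> \<alpha>" by simp
    have "((\<lambda>x. x - \<alpha>) has_real_derivative 1) (at x)" by (auto intro!: derivative_eq_intros)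
    then have "((\<lambda>x. (x - \<alpha>) * ln \<bar>x - \<alpha>\<bar> - x) has_real_derivative
        (1 * ln \<bar>x - \<alpha>\<bar> + 1 / (x - \<alpha>) * (x - \<alpha>)) - 1) (at x)"
      by (intro DERIV_diff DERIV_mult DERIV_ident DERIV_ln_abs_shift x)
    then have "((\<lambda>x. (x - \<alpha>) * ln \<bar>x - \<alpha>\<bar> - x) has_real_derivative ln \<bar>x - \<alpha>\<bar>) (at x)"
      using x by simp
    then show "((\<lambda>x. (x - \<alpha>) * ln \<bar>x - \<alpha>\<bar> - x) has_vector_derivative ln \<bar>x - \<alpha>\<bar>) (at x)"
      by (simp add: has_real_derivative_iff_has_vector_derivative)
  next
    have "isCont (\<lambda>x. (x - \<alpha>) * ln \<bar>x - \<alpha>\<bar>) x" for x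
    proof (cases "x = \<alpha>")
      case True
      then show ?thesis using x_ln_abs_shift_tendsto_0[of \<alpha> UNIV] by (simp add: isCont_def)
    next
      case False
      then show ?thesis by (intro continuous_intros) auto
    qed
    then show "continuous_on {-1..1} (\<lambda>x. (x - \<alpha>) * ln \<bar>x - \<alpha>\<bar> - x)"
      by (intro continuous_intros continuous_at_imp_continuous_on) auto
  qed auto
  then have "(\<lambda>x. ln \<bar>x - \<alpha>\<bar>) integrable_on {-1..1}" by blast
  \<comment> \<open>For nonnegative functions gauge integrability is absolute. The constant makes
    the function nonnegative, as \<open>ln \<bar>x - \<alpha>\<bar> \<le> \<bar>x - \<alpha>\<bar>
    \<le> \<bar>\<alpha>\<bar> + 1\<close>, and is subtracted again afterwards.\<close>
  then have "(\<lambda>x. (\<bar>\<alpha>\<bar> + 1) - ln \<bar>x - \<alpha>\<bar>) integrable_on {-1..1}"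
    by (intro integrable_diff) auto
  then have "(\<lambda>x. (\<bar>\<alpha>\<bar> + 1) - ln \<bar>x - \<alpha>\<bar>) absolutely_integrable_on {-1..1}"
  proof (rule nonnegative_absolutely_integrable_1)
    fix x :: real assume "x \<in> {-1..1}"
    then show "0 \<le> (\<bar>\<alpha>\<bar> + 1) - ln \<bar>x - \<alpha>\<bar>"
      using ln_less_self[of "\<bar>x - \<alpha>\<bar>"] by (cases "x = \<alpha>") (auto simp del: ln_less_self)
  qed
  moreover have "(\<lambda>x::real. \<bar>\<alpha>\<bar> + 1) absolutely_integrable_on {-1..1}"
    by (rule absolutely_integrable_continuous_real) (rule continuous_on_const)
  ultimately have "set_integrable lebesgue {-1..1} (\<lambda>x. (\<bar>\<alpha>\<bar> + 1) - ((\<bar>\<alpha>\<bar> + 1) - ln \<bar>x - \<alpha>\<bar>))"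
    by (rule set_integral_diff(1)[rotated])
  then have "integrable lebesgue (\<lambda>x. indicator {-1..1} x *\<^sub>R ln \<bar>x - \<alpha>\<bar>)"
    by (simp add: set_integrable_def)
  then show ?thesis
    unfolding set_integrable_def by (subst (asm) integrable_completion) auto
qed

lemma set_integrable_log_comb:
  fixes p q :: "real \<Rightarrow> real"
  assumes p: "continuous_on {-1..1} p" and q: "continuous_on {-1..1} q"
  shows "set_integrable lborel {-1..1} (\<lambda>x. p x + q x * ln \<bar>x - \<alpha>\<bar>)"
proof (rule set_integral_add)
  show "set_integrable lborel {-1..1} p" by (rule borel_integrable_atLeastAtMost'[OF p])
  obtain B where B: "\<And>x. x \<in> {-1..1} \<Longrightarrow> \<bar>q x\<bar> \<le> B"
  proof -
    have "bounded (q ` {-1..1})" using q by (intro compact_imp_bounded compact_continuous_image) auto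
    then show ?thesis using that unfolding bounded_iff by (auto simp del: atLeastAtMost_iff)
  qed
  show "set_integrable lborel {-1..1} (\<lambda>x. q x * ln \<bar>x - \<alpha>\<bar>)"
  proof (rule set_integrable_bound)
    show "set_integrable lborel {-1..1} (\<lambda>x. B * ln \<bar>x - \<alpha>\<bar>)"
      using set_integrable_ln_shift by auto
    have "(\<lambda>x. indicator {-1..1} x *\<^sub>R q x) \<in> borel_measurable borel"
      by (rule borel_measurable_continuous_on_indicator[OF _ q]) auto
    then have "(\<lambda>x. (indicator {-1..1} x *\<^sub>R q x) * ln \<bar>x - \<alpha>\<bar>) \<in> borel_measurable borel"
      by measurable
    then show "set_borel_measurable lborel {-1..1} (\<lambda>x. q x * ln \<bar>x - \<alpha>\<bar>)"
      by (simp add: set_borel_measurable_def mult.assoc)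
    show "AE x in lborel. x \<in> {-1..1} \<longrightarrow> norm (q x * ln \<bar>x - \<alpha>\<bar>) \<le> norm (B * ln \<bar>x - \<alpha>\<bar>)"
      by (auto simp: abs_mult simp del: atLeastAtMost_iff intro!: AE_I2 mult_right_mono order_trans[OF B])
  qed
qed

section \<open>The interpolation operator\<close>

lemma span_on_monomials_continuous: "p \<in> span_on monomials n \<Longrightarrow> continuous_on {-1..1} p"
proof -
  assume "p \<in> span_on monomials n"
  then obtain a where "\<And>x. x \<in> {-1..1} \<Longrightarrow> p x = (\<Sum>j<n. a j * x ^ j)" unfolding span_on_def by blast
  then show ?thesis by (subst continuous_on_cong[OF refl]) (auto intro!: continuous_intros)
qed

text \<open>Replacing coefficients by polynomial factors \<open>p\<close> and \<open>q\<close> lets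
  the closure properties of \<open>span_on\<close> carry over to \<open>log_space\<close>.\<close>

lemma log_space_iff:
  "u \<in> log_space \<alpha> n1 n2 \<longleftrightarrow> u \<in> extensional (punctured \<alpha>) \<and>
    (\<exists>p\<in>span_on monomials n1. \<exists>q\<in>span_on monomials n2. \<forall>x\<in>punctured \<alpha>. u x = p x + q x * ln \<bar>x - \<alpha>\<bar>)"
  (is "_ \<longleftrightarrow> ?R")
proof
  assume "u \<in> log_space \<alpha> n1 n2"
  then obtain a b where u: "u = restrict (\<lambda>x. (\<Sum>j<n1. a j * x ^ j) + (\<Sum>k<n2. b k * (x ^ k * ln \<bar>x - \<alpha>\<bar>)))
      (punctured \<alpha>)" unfolding log_space_def by blast
  have "(\<lambda>x. \<Sum>j<n1. a j * x ^ j) \<in> span_on monomials n1" "(\<lambda>x. \<Sum>k<n2. b k * x ^ k) \<in> span_on monomials n2"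
    unfolding span_on_def by blast+
  moreover have "\<forall>x\<in>punctured \<alpha>. u x = (\<Sum>j<n1. a j * x ^ j) + (\<Sum>k<n2. b k * x ^ k) * ln \<bar>x - \<alpha>\<bar>"
    by (simp add: u sum_distrib_right mult.assoc)
  moreover have "u \<in> extensional (punctured \<alpha>)" by (simp add: u)
  ultimately show ?R by (intro conjI) (assumption | rule bexI)+
next
  assume R: ?R
  then obtain p q where p: "p \<in> span_on monomials n1" and q: "q \<in> span_on monomials n2"
    and u: "\<forall>x\<in>punctured \<alpha>. u x = p x + q x * ln \<bar>x - \<alpha>\<bar>" by blast
  obtain a where a: "\<forall>x\<in>{-1..1}. p x = (\<Sum>j<n1. a j * x ^ j)" using p unfolding span_on_def by blast
  obtain b where b: "\<forall>x\<in>{-1..1}. q x = (\<Sum>j<n2. b j * x ^ j)" using q unfolding span_on_def by blast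
  have "u = restrict (\<lambda>x. (\<Sum>j<n1. a j * x ^ j) + (\<Sum>k<n2. b k * (x ^ k * ln \<bar>x - \<alpha>\<bar>))) (punctured \<alpha>)"
  proof (rule extensionalityI[of _ "punctured \<alpha>"])
    fix x assume x: "x \<in> punctured \<alpha>"
    then have "x \<in> {-1..1}" by (simp add: punctured_def)
    then show "u x = restrict (\<lambda>x. (\<Sum>j<n1. a j * x ^ j) + (\<Sum>k<n2. b k * (x ^ k * ln \<bar>x - \<alpha>\<bar>))) (punctured \<alpha>) x"
      using u a b x by (simp add: sum_distrib_right mult.assoc)
  qed (use R in auto)
  then show "u \<in> log_space \<alpha> n1 n2" unfolding log_space_def by blast
qed

lemma log_space_integrable: "u \<in> log_space \<alpha> n1 n2 \<Longrightarrow> set_integrable lborel {-1..1} u"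
proof -
  assume "u \<in> log_space \<alpha> n1 n2"
  then obtain p q where p: "p \<in> span_on monomials n1" and q: "q \<in> span_on monomials n2"
    and u: "\<And>x. x \<in> punctured \<alpha> \<Longrightarrow> u x = p x + q x * ln \<bar>x - \<alpha>\<bar>" unfolding log_space_iff by blast
  show ?thesis
    by (subst integrable_cong_punctured[OF u])
      (auto intro: set_integrable_log_comb span_on_monomials_continuous p q)
qed

lemma log_space_lincomb:
  assumes "\<And>i. i \<in> A \<Longrightarrow> u i \<in> log_space \<alpha> n1 n2"
  shows "restrict (\<lambda>x. \<Sum>i\<in>A. c i * u i x) (punctured \<alpha>) \<in> log_space \<alpha> n1 n2"
proof -
  have "\<forall>i\<in>A. \<exists>p q. p \<in> span_on monomials n1 \<and> q \<in> span_on monomials n2 \<and>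
      (\<forall>x\<in>punctured \<alpha>. u i x = p x + q x * ln \<bar>x - \<alpha>\<bar>)"
    using assms unfolding log_space_iff by blast
  then obtain p q where pq: "\<And>i. i \<in> A \<Longrightarrow> p i \<in> span_on monomials n1"
    "\<And>i. i \<in> A \<Longrightarrow> q i \<in> span_on monomials n2"
    "\<And>i x. i \<in> A \<Longrightarrow> x \<in> punctured \<alpha> \<Longrightarrow> u i x = p i x + q i x * ln \<bar>x - \<alpha>\<bar>"
    by metis
  have "\<forall>x\<in>punctured \<alpha>. (\<Sum>i\<in>A. c i * u i x)
      = (\<Sum>i\<in>A. c i * p i x) + (\<Sum>i\<in>A. c i * q i x) * ln \<bar>x - \<alpha>\<bar>"
    by (simp add: pq(3) sum_distrib_right sum.distrib[symmetric] distrib_left mult.assoc)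
  moreover have "(\<lambda>x. \<Sum>i\<in>A. c i * p i x) \<in> span_on monomials n1" "(\<lambda>x. \<Sum>i\<in>A. c i * q i x) \<in> span_on monomials n2"
    by (auto intro!: span_on_sum span_on_scale pq)
  ultimately show ?thesis unfolding log_space_iff by auto
qed

lemma log_space_diff:
  assumes "u \<in> log_space \<alpha> n1 n2" "v \<in> log_space \<alpha> n1 n2"
  shows "restrict (\<lambda>x. u x - v x) (punctured \<alpha>) \<in> log_space \<alpha> n1 n2"
  using log_space_lincomb[of "{True, False}" "\<lambda>b. if b then u else v" \<alpha> n1 n2 "\<lambda>b. if b then 1 else - 1"] assms
  by simp

lemma log_spaceI:
  assumes "p \<in> span_on monomials n1" "q \<in> span_on monomials n2"
  shows "restrict (\<lambda>x. p x + q x * ln \<bar>x - \<alpha>\<bar>) (punctured \<alpha>) \<in> log_space \<alpha> n1 n2"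
  unfolding log_space_iff using assms by auto

lemma interp_props:
  fixes f :: "real \<Rightarrow> real"
  assumes "uniquely_solvable \<alpha> n1 n2 X" "continuous_on (punctured \<alpha>) f"
  shows interp_in: "interp \<alpha> n1 n2 X f \<in> log_space \<alpha> n1 n2"
    and interp_at: "x \<in> X \<Longrightarrow> interp \<alpha> n1 n2 X f x = f x"
    and interp_unique: "u \<in> log_space \<alpha> n1 n2 \<Longrightarrow> (\<And>x. x \<in> X \<Longrightarrow> u x = f x) \<Longrightarrow> interp \<alpha> n1 n2 X f = u"
proof -
  have ex: "\<exists>!u. u \<in> log_space \<alpha> n1 n2 \<and> (\<forall>x\<in>X. u x = f x)"
    using assms unfolding uniquely_solvable_def by blast
  show "interp \<alpha> n1 n2 X f \<in> log_space \<alpha> n1 n2" "x \<in> X \<Longrightarrow> interp \<alpha> n1 n2 X f x = f x"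
    using theI'[OF ex] unfolding interp_def by auto
  show "u \<in> log_space \<alpha> n1 n2 \<Longrightarrow> (\<And>x. x \<in> X \<Longrightarrow> u x = f x) \<Longrightarrow> interp \<alpha> n1 n2 X f = u"
    unfolding interp_def using the1_equality[OF ex] by blast
qed

text \<open>The function \<open>S f - v\<close> lies in the space and agrees with
  \<open>w = f - v\<close> at the nodes, so by uniqueness it is \<open>S w\<close>, and
  \<open>v\<close> cancels.\<close>

lemma interp_diff_log_space:
  assumes "uniquely_solvable \<alpha> n1 n2 X" "X \<subseteq> punctured \<alpha>"
    and "continuous_on (punctured \<alpha>) f" "continuous_on (punctured \<alpha>) w"
    and "v \<in> log_space \<alpha> n1 n2" "\<And>x. x \<in> punctured \<alpha> \<Longrightarrow> w x = f x - v x" "x \<in> punctured \<alpha>"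
  shows "f x - interp \<alpha> n1 n2 X f x = w x - interp \<alpha> n1 n2 X w x"
proof -
  have "interp \<alpha> n1 n2 X w = restrict (\<lambda>x. interp \<alpha> n1 n2 X f x - v x) (punctured \<alpha>)"
    using assms by (intro interp_unique log_space_diff) (auto simp: interp_in interp_at)
  then show ?thesis using assms(6,7) by simp
qed

text \<open>The operator has finite rank: by uniqueness \<open>S f\<close> is the combination of the
  cardinal interpolants \<open>S (\<phi> x)\<close> with weights \<open>f x\<close>, so the sum of
  their norms serves as \<open>B\<close>.\<close>

lemma interp_norm1_bound:
  assumes us: "uniquely_solvable \<alpha> n1 n2 X" and X: "X \<subseteq> punctured \<alpha>" "finite X"
  obtains B where "\<And>f M. continuous_on (punctured \<alpha>) f \<Longrightarrow> (\<And>x. x \<in> punctured \<alpha> \<Longrightarrow> \<bar>f x\<bar> \<le> M) \<Longrightarrow>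
    norm1 (interp \<alpha> n1 n2 X f) \<le> B * M"
proof
  \<comment> \<open>Lagrange polynomials of the nodes; only their continuity and their values 0 and
    1 at the nodes matter.\<close>
  define \<phi> where "\<phi> x t = (\<Prod>y\<in>X - {x}. (t - y) / (x - y))" for x t :: real
  have cont: "continuous_on (punctured \<alpha>) (\<phi> x)" for x
    unfolding \<phi>_def[abs_def] by (cases "\<exists>y\<in>X - {x}. x = y") (auto intro!: continuous_intros)
  have \<phi>1: "\<phi> x x = 1" for x unfolding \<phi>_def by (rule prod.neutral) auto
  have \<phi>0: "\<phi> x y = 0" if "y \<in> X" "y \<noteq> x" for x y
    unfolding \<phi>_def using that X by (intro prod_zero) auto
  fix f :: "real \<Rightarrow> real" and M :: real
  assume f: "continuous_on (punctured \<alpha>) f" and M: "\<And>x. x \<in> punctured \<alpha> \<Longrightarrow> \<bar>f x\<bar> \<le> M"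
  have "interp \<alpha> n1 n2 X f = restrict (\<lambda>t. \<Sum>x\<in>X. f x * interp \<alpha> n1 n2 X (\<phi> x) t) (punctured \<alpha>)"
  proof (rule interp_unique[OF us f])
    show "restrict (\<lambda>t. \<Sum>x\<in>X. f x * interp \<alpha> n1 n2 X (\<phi> x) t) (punctured \<alpha>) \<in> log_space \<alpha> n1 n2"
      by (intro log_space_lincomb interp_in[OF us cont])
    fix y assume y: "y \<in> X"
    have "(\<Sum>x\<in>X. f x * interp \<alpha> n1 n2 X (\<phi> x) y) = (\<Sum>x\<in>X. if x = y then f x else 0)"
      using y \<phi>0 \<phi>1 by (intro sum.cong) (auto simp: interp_at[OF us cont])
    then show "restrict (\<lambda>t. \<Sum>x\<in>X. f x * interp \<alpha> n1 n2 X (\<phi> x) t) (punctured \<alpha>) y = f y"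
      using y X by auto
  qed
  then have "norm1 (interp \<alpha> n1 n2 X f) = norm1 (\<lambda>t. \<Sum>x\<in>X. f x * interp \<alpha> n1 n2 X (\<phi> x) t)"
    by (intro norm1_cong[of \<alpha>]) simp
  also have "\<dots> \<le> (\<Sum>x\<in>X. \<bar>f x\<bar> * norm1 (interp \<alpha> n1 n2 X (\<phi> x)))"
    by (intro norm1_lincomb_le X log_space_integrable[OF interp_in[OF us cont]])
  also have "\<dots> \<le> (\<Sum>x\<in>X. M * norm1 (interp \<alpha> n1 n2 X (\<phi> x)))"
    using X M norm1_nonneg by (intro sum_mono mult_right_mono) auto
  also have "\<dots> = (\<Sum>x\<in>X. norm1 (interp \<alpha> n1 n2 X (\<phi> x))) * M"
    by (simp add: sum_distrib_left mult.commute)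
  finally show "norm1 (interp \<alpha> n1 n2 X f) \<le> (\<Sum>x\<in>X. norm1 (interp \<alpha> n1 n2 X (\<phi> x))) * M" .
qed

section \<open>Operator norm and interpolation error\<close>

lemma punctured_nonempty: "punctured \<alpha> \<noteq> {}"
proof -
  have "0 \<in> punctured \<alpha> \<or> 1 \<in> punctured \<alpha>" by (auto simp: punctured_def)
  then show ?thesis by blast
qed

lemma sup_norm_nonneg: "sup_norm \<alpha> f \<ge> 0"
proof -
  obtain t where "t \<in> punctured \<alpha>" using punctured_nonempty by blast
  then show ?thesis unfolding sup_norm_def by (intro SUP_upper2[of t]) auto
qed

lemma abs_le_sup_norm: "x \<in> punctured \<alpha> \<Longrightarrow> ereal \<bar>f x\<bar> \<le> sup_norm \<alpha> f"
  unfolding sup_norm_def by (rule SUP_upper)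

text \<open>A real \<open>SUP\<close> gives information only for a set bounded above. Bounded
  \<open>f\<close> are covered by the finite-rank estimate; unbounded \<open>f\<close> contribute
  0.\<close>

lemma op_norm_bdd_above:
  assumes us: "uniquely_solvable \<alpha> n1 n2 X" and X: "X \<subseteq> punctured \<alpha>" "finite X"
  shows "bdd_above ((\<lambda>f. norm1 (interp \<alpha> n1 n2 X f) * real_of_ereal (1 / sup_norm \<alpha> f)) `
    {f. continuous_on (punctured \<alpha>) f \<and> sup_norm \<alpha> f \<noteq> 0})"
proof -
  obtain B where B: "\<And>f M. continuous_on (punctured \<alpha>) f \<Longrightarrow> (\<And>x. x \<in> punctured \<alpha> \<Longrightarrow> \<bar>f x\<bar> \<le> M) \<Longrightarrow>
    norm1 (interp \<alpha> n1 n2 X f) \<le> B * M"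
    using interp_norm1_bound[OF assms] by blast
  have "norm1 (interp \<alpha> n1 n2 X f) * real_of_ereal (1 / sup_norm \<alpha> f) \<le> max B 0"
    if f: "continuous_on (punctured \<alpha>) f" "sup_norm \<alpha> f \<noteq> 0" for f
  proof (cases "sup_norm \<alpha> f")
    case (real s)
    then have s: "s > 0" using f(2) sup_norm_nonneg[of \<alpha> f] by (auto simp: zero_ereal_def less_le)
    have "norm1 (interp \<alpha> n1 n2 X f) \<le> B * s"
      using abs_le_sup_norm[of _ \<alpha> f] real by (intro B f) auto
    then have "norm1 (interp \<alpha> n1 n2 X f) / s \<le> B" using s by (simp add: divide_le_eq)
    then show ?thesis using s real by (simp add: one_ereal_def divide_inverse)
  qed (use sup_norm_nonneg[of \<alpha> f] in auto)
  then show ?thesis by (intro bdd_aboveI2[where M = "max B 0"]) auto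
qed

lemma op_norm_nonneg:
  assumes us: "uniquely_solvable \<alpha> n1 n2 X" and X: "X \<subseteq> punctured \<alpha>" "finite X"
  shows "op_norm_1_inf \<alpha> n1 n2 X \<ge> 0"
proof -
  have "sup_norm \<alpha> (\<lambda>_. 1) = 1" unfolding sup_norm_def using punctured_nonempty by (simp add: one_ereal_def)
  then have "norm1 (interp \<alpha> n1 n2 X (\<lambda>_. 1)) * real_of_ereal (1 / sup_norm \<alpha> (\<lambda>_. 1)) \<le> op_norm_1_inf \<alpha> n1 n2 X"
    unfolding op_norm_1_inf_def by (intro cSUP_upper op_norm_bdd_above[OF assms]) auto
  moreover have "norm1 (interp \<alpha> n1 n2 X (\<lambda>_. 1)) * real_of_ereal (1 / sup_norm \<alpha> (\<lambda>_. 1)) \<ge> 0"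
    using \<open>sup_norm \<alpha> (\<lambda>_. 1) = 1\<close> norm1_nonneg by (simp add: one_ereal_def)
  ultimately show ?thesis by linarith
qed

lemma norm1_interp_le:
  assumes us: "uniquely_solvable \<alpha> n1 n2 X" and X: "X \<subseteq> punctured \<alpha>" "finite X"
    and w: "continuous_on (punctured \<alpha>) w" and M: "\<And>x. x \<in> punctured \<alpha> \<Longrightarrow> \<bar>w x\<bar> \<le> M"
  shows "norm1 (interp \<alpha> n1 n2 X w) \<le> op_norm_1_inf \<alpha> n1 n2 X * M"
proof -
  have op: "op_norm_1_inf \<alpha> n1 n2 X \<ge> 0" by (rule op_norm_nonneg[OF us X])
  obtain t where t: "t \<in> punctured \<alpha>" using punctured_nonempty by blast
  have M0: "M \<ge> 0" using M[OF t] by linarith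
  have le: "sup_norm \<alpha> w \<le> ereal M" unfolding sup_norm_def using M by (intro SUP_least) auto
  show ?thesis
  proof (cases "sup_norm \<alpha> w = 0")
    \<comment> \<open>Functions of norm 0 are excluded from the supremum. They vanish on the
      punctured interval, so their interpolant is 0 by uniqueness.\<close>
    case True
    then have "\<bar>w x\<bar> \<le> 0" if "x \<in> punctured \<alpha>" for x
      using abs_le_sup_norm[OF that, of w] by (simp add: zero_ereal_def)
    then have w0: "w x = 0" if "x \<in> punctured \<alpha>" for x using that by force
    have "interp \<alpha> n1 n2 X w = restrict (\<lambda>x. 0 + 0 * ln \<bar>x - \<alpha>\<bar>) (punctured \<alpha>)"
      using X by (intro interp_unique[OF us w] log_spaceI span_on_zero) (auto simp: w0)
    then have "norm1 (interp \<alpha> n1 n2 X w) = norm1 (\<lambda>x. 0)" by (intro norm1_cong[of \<alpha>]) auto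
    then show ?thesis using op M0 by (simp add: norm1_def)
  next
    case False
    obtain s where s: "sup_norm \<alpha> w = ereal s" "s > 0" "s \<le> M"
      using False le sup_norm_nonneg[of \<alpha> w] by (cases "sup_norm \<alpha> w") (auto simp: zero_ereal_def less_le)
    have "norm1 (interp \<alpha> n1 n2 X w) * real_of_ereal (1 / sup_norm \<alpha> w) \<le> op_norm_1_inf \<alpha> n1 n2 X"
      unfolding op_norm_1_inf_def using w False by (intro cSUP_upper op_norm_bdd_above[OF us X]) auto
    then have "norm1 (interp \<alpha> n1 n2 X w) \<le> op_norm_1_inf \<alpha> n1 n2 X * s"
      using s by (simp add: one_ereal_def divide_inverse[symmetric] divide_le_eq)
    also have "\<dots> \<le> op_norm_1_inf \<alpha> n1 n2 X * M" using s op by (intro mult_left_mono) auto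
    finally show ?thesis .
  qed
qed

lemma norm1_le_const:
  assumes "set_integrable lborel {-1..1} u" "\<And>x. x \<in> punctured \<alpha> \<Longrightarrow> \<bar>u x\<bar> \<le> M"
  shows "norm1 u \<le> 2 * M"
proof -
  have "norm1 u \<le> (LBINT x:{-1..1::real}. M)"
    unfolding norm1_def using borel_integrable_atLeastAtMost'[OF continuous_on_const, of "-1" 1 M] assms
    by (intro integral_le_punctured[of _ _ \<alpha>] set_integrable_abs) auto
  also have "\<dots> = 2 * M" by (simp add: set_integral_const)
  finally show ?thesis .
qed

text \<open>Passing from \<open>f\<close> to \<open>w = f - v\<close> leaves the error unchanged.
  Then \<open>w\<close> itself contributes at most \<open>2 * M\<close>, the interval having length
  2, and \<open>S w\<close> at most the operator norm times \<open>M\<close>.\<close>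

lemma interpolation_error_le:
  assumes us: "uniquely_solvable \<alpha> n1 n2 X" and X: "X \<subseteq> punctured \<alpha>" "finite X"
    and f: "continuous_on (punctured \<alpha>) f" "set_integrable lborel {-1..1} f"
    and v: "v \<in> log_space \<alpha> n1 n2" and M: "\<And>x. x \<in> punctured \<alpha> \<Longrightarrow> \<bar>f x - v x\<bar> \<le> M"
  shows "norm1 (\<lambda>x. f x - interp \<alpha> n1 n2 X f x) \<le> 2 * M * (1 + op_norm_1_inf \<alpha> n1 n2 X)"
proof -
  define w where "w x = f x - v x" for x
  obtain p q where p: "p \<in> span_on monomials n1" and q: "q \<in> span_on monomials n2"
    and pq: "\<And>x. x \<in> punctured \<alpha> \<Longrightarrow> v x = p x + q x * ln \<bar>x - \<alpha>\<bar>" using v unfolding log_space_iff by blast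
  have sub: "punctured \<alpha> \<subseteq> {-1..1}" by (auto simp: punctured_def)
  have "continuous_on (punctured \<alpha>) (\<lambda>x. p x + q x * ln \<bar>x - \<alpha>\<bar>)"
    using continuous_on_subset[OF span_on_monomials_continuous[OF p] sub]
      continuous_on_subset[OF span_on_monomials_continuous[OF q] sub]
    by (intro continuous_intros) (auto simp: punctured_def)
  then have "continuous_on (punctured \<alpha>) v" using pq by (subst continuous_on_cong[OF refl pq]) auto
  then have w: "continuous_on (punctured \<alpha>) w" unfolding w_def by (intro continuous_on_diff f)
  have wi: "set_integrable lborel {-1..1} w"
    unfolding w_def using f(2) log_space_integrable[OF v] by (rule set_integral_diff)
  have Si: "set_integrable lborel {-1..1} (\<lambda>x. - 1 * interp \<alpha> n1 n2 X w x)"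
    using log_space_integrable[OF interp_in[OF us w]] by (intro set_integrable_mult_right)
  have "norm1 (\<lambda>x. f x - interp \<alpha> n1 n2 X f x) = norm1 (\<lambda>x. w x + - 1 * interp \<alpha> n1 n2 X w x)"
    using interp_diff_log_space[OF us X(1) f(1) w v] by (intro norm1_cong[of \<alpha>]) (simp add: w_def)
  also have "\<dots> \<le> norm1 w + norm1 (interp \<alpha> n1 n2 X w)"
    using norm1_add_le[OF wi Si] unfolding norm1_mult by simp
  also have "\<dots> \<le> 2 * M + op_norm_1_inf \<alpha> n1 n2 X * M"
    using M by (intro add_mono norm1_le_const[OF wi] norm1_interp_le[OF us X w]) (auto simp: w_def)
  also have "\<dots> \<le> 2 * M * (1 + op_norm_1_inf \<alpha> n1 n2 X)"
  proof -
    obtain t where t: "t \<in> punctured \<alpha>" using punctured_nonempty by blast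
    have "M \<ge> 0" using M[OF t] by linarith
    then show ?thesis using op_norm_nonneg[OF us X] by (simp add: algebra_simps)
  qed
  finally show ?thesis .
qed

section \<open>The quadrature as integral of the interpolant\<close>

text \<open>Termwise integration of the Chebyshev form. The choice made by
  \<open>cheb_coeffs\<close> is immaterial: any coefficients representing the interpolant off
  \<alpha> give its integral.\<close>

lemma quadrature_eq_integral:
  assumes us: "uniquely_solvable \<alpha> n1 n2 X" and f: "continuous_on (punctured \<alpha>) f"
  shows "quadrature \<alpha> n1 n2 X f = (LBINT x:{-1..1}. interp \<alpha> n1 n2 X f x)"
proof -
  define u where "u = interp \<alpha> n1 n2 X f"
  define P where "P = (\<lambda>(a, b). \<forall>x\<in>punctured \<alpha>.
     u x = (\<Sum>j<n1. a j * cheb_T j x) + ln \<bar>x - \<alpha>\<bar> * (\<Sum>k<n2. b k * cheb_T k x))"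
  obtain p q where "p \<in> span_on monomials n1" "q \<in> span_on monomials n2"
    and u: "\<And>x. x \<in> punctured \<alpha> \<Longrightarrow> u x = p x + q x * ln \<bar>x - \<alpha>\<bar>"
    using interp_in[OF us f] unfolding log_space_iff u_def by blast
  \<comment> \<open>Existence of a Chebyshev representation, without which the \<open>SOME\<close>
    in \<open>cheb_coeffs\<close> would be unspecified.\<close>
  then have "p \<in> span_on cheb_T n1" "q \<in> span_on cheb_T n2" by (auto intro: monomials_subset_cheb_T)
  then obtain a0 b0 where "\<forall>x\<in>{-1..1}. p x = (\<Sum>j<n1. a0 j * cheb_T j x)"
    "\<forall>x\<in>{-1..1}. q x = (\<Sum>j<n2. b0 j * cheb_T j x)" unfolding span_on_def by blast
  then have "P (a0, b0)" unfolding P_def using u by (auto simp: punctured_def)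
  then have "P (cheb_coeffs \<alpha> n1 n2 u)" unfolding cheb_coeffs_def P_def[symmetric] by (rule someI)
  moreover obtain a b where ab: "cheb_coeffs \<alpha> n1 n2 u = (a, b)" by fastforce
  ultimately have eq: "\<And>x. x \<in> punctured \<alpha> \<Longrightarrow>
      u x = (\<Sum>j<n1. a j * cheb_T j x) + (\<Sum>k<n2. b k * (cheb_T k x * ln \<bar>x - \<alpha>\<bar>))"
    unfolding P_def by (simp add: sum_distrib_left algebra_simps)
  have T: "continuous_on {-1..1} (cheb_T k)" for k
    by (rule span_on_monomials_continuous[OF cheb_T_in_monomials])
  have i1: "set_integrable lborel {-1..1} (\<lambda>x. c * cheb_T k x)" for k c
    using borel_integrable_atLeastAtMost'[OF T] by (intro set_integrable_mult_right)
  have i2: "set_integrable lborel {-1..1} (\<lambda>x. c * (cheb_T k x * ln \<bar>x - \<alpha>\<bar>))" for k c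
    using set_integrable_log_comb[OF continuous_on_const[of _ 0] T] by (intro set_integrable_mult_right) simp
  have "(LBINT x:{-1..1}. u x) = (LBINT x:{-1..1}. (\<Sum>j<n1. a j * cheb_T j x) + (\<Sum>k<n2. b k * (cheb_T k x * ln \<bar>x - \<alpha>\<bar>)))"
    by (rule integral_cong_punctured[OF eq])
  also have "\<dots> = (LBINT x:{-1..1}. (\<Sum>j<n1. a j * cheb_T j x)) + (LBINT x:{-1..1}. (\<Sum>k<n2. b k * (cheb_T k x * ln \<bar>x - \<alpha>\<bar>)))"
    by (intro set_integral_add set_integrable_sum_real i1 i2)
  also have "\<dots> = (\<Sum>j<n1. a j * xi1 j) + (\<Sum>j<n2. b j * xi2 \<alpha> j)"
    by (simp add: set_integrable_sum_real(2) i1 i2 xi1_def xi2_def)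
  finally show ?thesis unfolding quadrature_def u_def[symmetric] ab by simp
qed

section \<open>Assembly of the error estimate\<close>

theorem mainTheorem3:
  fixes \<alpha> :: real and n2 :: nat and g1 g2 K :: "real \<Rightarrow> real"
  assumes alpha: "\<alpha> \<in> {-1..1}"
    and n2: "n2 \<ge> 1"
    and g1: "smooth_on {-1..1} g1"
    and g2: "smooth_on {-1..1} g2"
    and K: "\<And>x. x \<in> punctured \<alpha> \<Longrightarrow> K x = g1 x + g2 x * ln \<bar>x - \<alpha>\<bar>"
  shows "\<exists>c::real. \<forall>(n1::nat) (Y::real set) X.
    n1 \<ge> n2 + 2 \<longrightarrow>
    finite Y \<longrightarrow> card Y = n2 \<longrightarrow> Y \<inter> cheb_points n1 = {} \<longrightarrow>
    X = cheb_points n1 \<union> Y \<longrightarrow> X \<subseteq> punctured \<alpha> \<longrightarrow>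
    uniquely_solvable \<alpha> n1 n2 X \<longrightarrow>
      \<bar>(LBINT x:{-1..1}. K x) - quadrature \<alpha> n1 n2 X K\<bar>
        = \<bar>LBINT x:{-1..1}. K x - interp \<alpha> n1 n2 X K x\<bar> \<and>
      \<bar>LBINT x:{-1..1}. K x - interp \<alpha> n1 n2 X K x\<bar>
        \<le> norm1 (\<lambda>x. K x - interp \<alpha> n1 n2 X K x) \<and>
      norm1 (\<lambda>x. K x - interp \<alpha> n1 n2 X K x)
        \<le> 8 * c * (1 + op_norm_1_inf \<alpha> n1 n2 X)
            / (pi * real n2 * (\<Prod>i=1..n2. (real n1 - real i)))"
proof -
  have sub: "punctured \<alpha> \<subseteq> {-1..1}" by (auto simp: punctured_def)
  obtain p h where p: "p \<in> span_on monomials n2" and h: "smooth_on {-1..1} h"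
    and g2_eq: "\<forall>x\<in>{-1..1}. g2 x = p x + (x - \<alpha>) ^ n2 * h x"
    using smooth_on_taylor[OF g2 alpha] by blast
  obtain m where m: "n2 = Suc m" using n2 by (cases n2) auto
  obtain C where C: "C \<ge> 0" and approx: "\<And>n. n \<ge> m + 2 \<Longrightarrow> \<exists>P\<in>span_on monomials n. \<forall>x\<in>{-1..1}.
      \<bar>g1 x + (x - \<alpha>) ^ n2 * h x * ln \<bar>x - \<alpha>\<bar> - P x\<bar> \<le> C / real n ^ n2"
    using approx_log[OF g1 h alpha, of m] unfolding m by blast
  have cont1: "continuous_on {-1..1} g1" and cont2: "continuous_on {-1..1} g2"
    using g1 g2 by (auto intro: smooth_on_continuous)
  have "continuous_on (punctured \<alpha>) (\<lambda>x. g1 x + g2 x * ln \<bar>x - \<alpha>\<bar>)"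
    using continuous_on_subset[OF cont1 sub] continuous_on_subset[OF cont2 sub]
    by (intro continuous_intros) (auto simp: punctured_def)
  then have Kc: "continuous_on (punctured \<alpha>) K" by (subst continuous_on_cong[OF refl K])
  have Ki: "set_integrable lborel {-1..1} K"
    by (subst integrable_cong_punctured[OF K]) (use set_integrable_log_comb[OF cont1 cont2] in auto)
  show ?thesis
  \<comment> \<open>The witness turns the factor \<open>8 * c / (pi * n2)\<close> into
    \<open>2 * C\<close>, the form given by \<open>interpolation_error_le\<close>. It is fixed
    before \<open>n1\<close> and the nodes are introduced.\<close>
  proof (intro exI[of _ "C * pi * real n2 / 4"] allI impI)
    fix n1 :: nat and Y X :: "real set"
    assume n1: "n1 \<ge> n2 + 2" and Y: "finite Y" and XY: "X = cheb_points n1 \<union> Y"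
      and X: "X \<subseteq> punctured \<alpha>" and us: "uniquely_solvable \<alpha> n1 n2 X"
    define op where "op = op_norm_1_inf \<alpha> n1 n2 X"
    define e where "e x = K x - interp \<alpha> n1 n2 X K x" for x
    have fin: "finite X" unfolding XY cheb_points_def using Y by simp
    have op: "op \<ge> 0" unfolding op_def by (rule op_norm_nonneg[OF us X fin])
    have Si: "set_integrable lborel {-1..1} (interp \<alpha> n1 n2 X K)"
      by (rule log_space_integrable[OF interp_in[OF us Kc]])
    have ei: "set_integrable lborel {-1..1} e" unfolding e_def by (rule set_integral_diff(1)[OF Ki Si])
    have "(LBINT x:{-1..1}. K x) - quadrature \<alpha> n1 n2 X K = (LBINT x:{-1..1}. e x)"
      unfolding quadrature_eq_integral[OF us Kc] e_def by (rule set_integral_diff(2)[OF Ki Si, symmetric])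
    moreover have "\<bar>LBINT x:{-1..1}. e x\<bar> \<le> norm1 e"
      using set_integral_norm_bound[OF ei] by (simp add: norm1_def)
    moreover have "norm1 e \<le> 8 * (C * pi * real n2 / 4) * (1 + op) / (pi * real n2 * (\<Prod>i=1..n2. (real n1 - real i)))"
    proof -
      obtain P where P: "P \<in> span_on monomials n1"
        "\<forall>x\<in>{-1..1}. \<bar>g1 x + (x - \<alpha>) ^ n2 * h x * ln \<bar>x - \<alpha>\<bar> - P x\<bar> \<le> C / real n1 ^ n2"
        using approx[of n1] n1 m by auto
      \<comment> \<open>The Taylor part \<open>p\<close> of \<open>g2\<close> is matched exactly by
        the logarithmic component of the space; \<open>P\<close> approximates everything
        else.\<close>
      define v where "v = restrict (\<lambda>x. P x + p x * ln \<bar>x - \<alpha>\<bar>) (punctured \<alpha>)"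
      have v: "v \<in> log_space \<alpha> n1 n2" unfolding v_def by (rule log_spaceI[OF P(1) p])
      have "\<bar>K x - v x\<bar> \<le> C / real n1 ^ n2" if x: "x \<in> punctured \<alpha>" for x
      proof -
        have x': "x \<in> {-1..1}" using x sub by blast
        have "K x - v x = g1 x + (x - \<alpha>) ^ n2 * h x * ln \<bar>x - \<alpha>\<bar> - P x"
          unfolding K[OF x] g2_eq[rule_format, OF x'] v_def restrict_apply'[OF x] by (simp add: algebra_simps)
        then show ?thesis using P(2) x' by simp
      qed
      then have "norm1 e \<le> 2 * (C / real n1 ^ n2) * (1 + op)"
        unfolding e_def op_def by (rule interpolation_error_le[OF us X fin Kc Ki v])
      \<comment> \<open>Each factor \<open>n1 - i\<close> is positive, as
        \<open>n1 \<ge> n2 + 2\<close>, and at most \<open>n1\<close>; the rate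
        \<open>n1 ^ (- n2)\<close> is therefore stronger than the one claimed.\<close>
      also have "\<dots> \<le> 2 * (C / (\<Prod>i=1..n2. (real n1 - real i))) * (1 + op)"
      proof -
        have pos: "0 < (\<Prod>i=1..n2. (real n1 - real i))" using n1 by (intro prod_pos) auto
        have "(\<Prod>i=1..n2. (real n1 - real i)) \<le> (\<Prod>i=1..n2. real n1)"
          using n1 by (intro prod_mono) auto
        then have "(\<Prod>i=1..n2. (real n1 - real i)) \<le> real n1 ^ n2" by simp
        with pos have "C / real n1 ^ n2 \<le> C / (\<Prod>i=1..n2. (real n1 - real i))"
          using C by (intro divide_left_mono) (auto intro: mult_pos_pos order_less_le_trans)
        then show ?thesis using op by (intro mult_right_mono mult_left_mono) auto
      qed
      also have "\<dots> = 8 * (C * pi * real n2 / 4) * (1 + op) / (pi * real n2 * (\<Prod>i=1..n2. (real n1 - real i)))"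
        using n2 by simp
      finally show ?thesis .
    qed
    ultimately show "\<bar>(LBINT x:{-1..1}. K x) - quadrature \<alpha> n1 n2 X K\<bar>
        = \<bar>LBINT x:{-1..1}. K x - interp \<alpha> n1 n2 X K x\<bar> \<and>
      \<bar>LBINT x:{-1..1}. K x - interp \<alpha> n1 n2 X K x\<bar>
        \<le> norm1 (\<lambda>x. K x - interp \<alpha> n1 n2 X K x) \<and>
      norm1 (\<lambda>x. K x - interp \<alpha> n1 n2 X K x)
        \<le> 8 * (C * pi * real n2 / 4) * (1 + op_norm_1_inf \<alpha> n1 n2 X)
            / (pi * real n2 * (\<Prod>i=1..n2. (real n1 - real i)))"
      unfolding e_def[abs_def] op_def by simp
  qed
qed

end
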